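(* Let $f\colon \mathbb{N}\to\mathbb{R}$ and let $\lambda$ be a partition of an integer $n\ge 2$. Put $$ c_{\lambda'} := \frac12\left[1+\sum_{i}\frac{\lambda_i'(\lambda_i'-1)}{n(n-1)}-\sum_{i}\frac{\lambda_i(\lambda_i-1)}{n(n-1)}\right],$$ and, for any partition $\mu$ of $n$, $$ d_{\mu}:=\sum_{i\ge j\ge k}\frac{\mu_i(\mu_j-1)(\mu_k-2)}{n(n-1)(n-2)},\qquad e_{\mu}:=\sum_{i\ge j\ge k\ge l}\frac{\mu_i(\mu_j-1)(\mu_k-2)(\mu_l-3)}{n(n-1)(n-2)(n-3)},$$ where in the sums defining $d_\mu$ and $e_\mu$ only the positive terms are included (so $\mu_k>2$ in $d_\mu$ and $\mu_l>3$ in $e_\mu$), an empty sum being $0$. Then $$ c_{\lambda'}=\sum_{i\ge j}\frac{\lambda_i'(\lambda_j'-1)}{n(n-1)},$$ the number of standard Young tableaux of shape $\lambda$ is $$N = n!\prod_{(i,j)\in\lambda}\{\lambda_i'+\lambda_j-i-j+1\}^{-1},$$ the expectation of the descent function $d_f$ over a uniformly random standard Young tableau of shape $\lambda$ is $$E_\lambda(d_f)=c_{\lambda'}\sum_{i=1}^{n-1}f(i),$$ and its variance is $$V_\lambda(d_f)=c_{\lambda'}\sum_{i=1}^{n-1}f(i)^2+2d_{\lambda'}\sum_{i=1}^{n-2}f(i)f(i+1)+2\left(c_{\lambda'}-d_\lambda-d_{\lambda'}+e_\lambda+e_{\lambda'}\right)\sum_{\substack{1\le j<i\le n-1\\ 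i-j>1}}f(i)f(j)-\left(c_{\lambda'}\sum_{i=1}^{n-1}f(i)\right)^2.$$
   Context: A partition $\lambda=(\lambda_1,\dots,\lambda_k)$ of $n$ is a non-increasing sequence of positive integers with sum $n$; it is identified with its Ferrers diagram, which has $\lambda_j$ cells in row $j$, rows being numbered from the top (north) downwards and columns from the left (west). $\lambda'$ denotes the conjugate partition, so $\lambda_i'$ is the length of column $i$. In the product over $(i,j)\in\lambda$, $(i,j)$ denotes the cell in column $i$ and row $j$. A standard Young tableau of shape $\lambda$ is a filling of the diagram with the numbers $1,\dots,n$, each used exactly once, such that every row (left to right) and every column (top to bottom) is increasing. A standard Young tableau $T$ has a descent at $i$ ($1\le i<n$) if the entry $i+1$ lies strictly south (and weakly west) of the entry $i$; $D(T)$ is the set of all descents of $T$. The descent function of $f\colon\mathbb{N}\to\mathbb{R}$ is $d_f(T):=\sum_{i\in D(T)}f(i)$. $E_\lambda(d_f)$ and $V_\lambda(d_f)$ are the expectation and the variance of $d_f$ under the uniform distribution on the standard Young tableaux of shape $\lambda$. In sums over indices of parts (such as $\sum_{i\ge j}$), indices run over the parts of the partition involved. *)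

theory Defs
  imports "HOL-Probability.Probability"
begin

definition is_partition :: "nat list \<Rightarrow> nat \<Rightarrow> bool" where
  "is_partition \<mu> n \<longleftrightarrow> sorted_wrt (\<ge>) \<mu> \<and> (\<forall>x\<in>set \<mu>. 0 < x) \<and> sum_list \<mu> = n"

text \<open>Parts, rows and columns are numbered from 1; \<open>part \<mu> i\<close> is 0 if there is no
  \<open>i\<close>-th part.\<close>

definition part :: "nat list \<Rightarrow> nat \<Rightarrow> nat" where
  "part \<mu> i = (if 1 \<le> i \<and> i \<le> length \<mu> then \<mu> ! (i - 1) else 0)"

text \<open>The cell \<open>(i, j)\<close> lies in column \<open>i\<close> and row \<open>j\<close> (column first); rows are numbered from
  north to south and columns from west to east.\<close>

definition diagram :: "nat list \<Rightarrow> (nat \<times> nat) set" where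
  "diagram \<mu> = {(i, j). 1 \<le> j \<and> j \<le> length \<mu> \<and> 1 \<le> i \<and> i \<le> part \<mu> j}"

definition conjugate :: "nat list \<Rightarrow> nat list" where
  "conjugate \<mu> = map (\<lambda>i. card {j. (i, j) \<in> diagram \<mu>}) [1..<Suc (part \<mu> 1)]"

text \<open>Fillings are extensional functions (a fixed dummy value outside the diagram), so that
  distinct elements of \<open>SYT \<mu>\<close> are distinct tableaux.\<close>

definition SYT :: "nat list \<Rightarrow> (nat \<times> nat \<Rightarrow> nat) set" where
  "SYT \<mu> = {T. T \<in> extensional (diagram \<mu>) \<and>
     bij_betw T (diagram \<mu>) {1..sum_list \<mu>} \<and>
     (\<forall>i i' j. (i, j) \<in> diagram \<mu> \<and> (i', j) \<in> diagram \<mu> \<and> i < i' \<longrightarrow> T (i, j) < T (i', j)) \<and>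
     (\<forall>i j j'. (i, j) \<in> diagram \<mu> \<and> (i, j') \<in> diagram \<mu> \<and> j < j' \<longrightarrow> T (i, j) < T (i, j'))}"

definition descents :: "nat list \<Rightarrow> (nat \<times> nat \<Rightarrow> nat) \<Rightarrow> nat set" where
  "descents \<mu> T = {m. 1 \<le> m \<and> m < sum_list \<mu> \<and>
     (\<exists>i j i' j'. (i, j) \<in> diagram \<mu> \<and> (i', j') \<in> diagram \<mu> \<and>
        T (i, j) = m \<and> T (i', j') = m + 1 \<and> j < j' \<and> i' \<le> i)}"

definition descent_fun :: "(nat \<Rightarrow> real) \<Rightarrow> nat list \<Rightarrow> (nat \<times> nat \<Rightarrow> nat) \<Rightarrow> real" where
  "descent_fun f \<mu> T = (\<Sum>m\<in>descents \<mu> T. f m)"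

definition expectation_SYT :: "nat list \<Rightarrow> ((nat \<times> nat \<Rightarrow> nat) \<Rightarrow> real) \<Rightarrow> real" where
  "expectation_SYT \<mu> X = measure_pmf.expectation (pmf_of_set (SYT \<mu>)) X"

definition variance_SYT :: "nat list \<Rightarrow> ((nat \<times> nat \<Rightarrow> nat) \<Rightarrow> real) \<Rightarrow> real" where
  "variance_SYT \<mu> X = measure_pmf.variance (pmf_of_set (SYT \<mu>)) X"

text \<open>\<open>c_conj \<mu>\<close> is the number written $c_{\mu'}$: the index is the conjugate of the
  argument. In contrast, \<open>d_coeff \<mu>\<close> and \<open>e_coeff \<mu>\<close> are $d_\mu$ and $e_\mu$.\<close>

definition c_conj :: "nat list \<Rightarrow> real" where
  "c_conj \<mu> = (let n = real (sum_list \<mu>); \<mu>' = conjugate \<mu> in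
     1 / 2 * (1 + (\<Sum>i=1..length \<mu>'. real (part \<mu>' i) * (real (part \<mu>' i) - 1) / (n * (n - 1)))
                - (\<Sum>i=1..length \<mu>. real (part \<mu> i) * (real (part \<mu> i) - 1) / (n * (n - 1)))))"

text \<open>If $n = 2$ (for \<open>d_coeff\<close>) or $n \le 3$ (for \<open>e_coeff\<close>), the denominator vanishes, but there
  are no positive terms and the sum is empty.\<close>

definition d_coeff :: "nat list \<Rightarrow> real" where
  "d_coeff \<mu> = (let n = real (sum_list \<mu>);
       t = (\<lambda>(i, j, k). real (part \<mu> i) * (real (part \<mu> j) - 1) * (real (part \<mu> k) - 2))
     in \<Sum>(i, j, k)\<in>{(i, j, k). 1 \<le> k \<and> k \<le> j \<and> j \<le> i \<and> i \<le> length \<mu> \<and> 0 < t (i, j, k)}.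
          t (i, j, k) / (n * (n - 1) * (n - 2)))"

definition e_coeff :: "nat list \<Rightarrow> real" where
  "e_coeff \<mu> = (let n = real (sum_list \<mu>);
       t = (\<lambda>(i, j, k, l). real (part \<mu> i) * (real (part \<mu> j) - 1) *
             (real (part \<mu> k) - 2) * (real (part \<mu> l) - 3))
     in \<Sum>(i, j, k, l)\<in>{(i, j, k, l). 1 \<le> l \<and> l \<le> k \<and> k \<le> j \<and> j \<le> i \<and> i \<le> length \<mu> \<and>
            0 < t (i, j, k, l)}.
          t (i, j, k, l) / (n * (n - 1) * (n - 2) * (n - 3)))"

end

theory Submission
  imports Defs
begin

text \<open>
  Record a standard tableau \<open>T\<close> of shape \<open>\<nu>\<close> as the word whose
  \<open>m\<close>-th letter is the row of the entry \<open>m\<close>. This is a bijection onto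
  the ballot words of content \<open>\<nu>\<close> (\<open>bij_betw_word_of\<close>), and the
  descents of \<open>T\<close> are the strict ascents of the word (\<open>descents_asc\<close>).
  So expectation and variance of \<open>d\<^sub>f\<close> only need the number of ballot words
  with one or two prescribed ascents.

  These numbers do not depend on the position of a single ascent, of a pair of adjacent ascents,
  or of a pair of ascents at distance at least two. The reason is that Knuth's elementary
  transformations of three consecutive letters preserve ballot words and exchange ``ascent, no
  ascent'' with ``no ascent, ascent''; sliding such moves along the word gives
  \<open>card_asc\<close>, \<open>card_double_asc\<close> and \<open>card_separated_asc\<close>.
  Hence all ascents may be pushed to the front, where an initial run of \<open>k\<close>
  non-descents means that \<open>1, \<dots>, k + 1\<close> fill the beginning of the first row,
  and, by transposition, an initial run of \<open>k\<close> descents means the same in the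
  conjugate shape. The pattern ``descents at 1 and 3'' reduces to such runs by inclusion and
  exclusion (\<open>card_descents_1_3\<close>), which is where \<open>c - d - d' + e + e'\<close>
  comes from.

  It remains to find the proportion of tableaux of shape \<open>\<lambda>\<close> with \<open>1,
  \<dots>, k\<close> in the first row. It is \<open>h\<^sup>*\<^sub>k(\<lambda>)\<close> divided
  by the falling factorial of \<open>n\<close>, where \<open>h\<^sup>*\<^sub>k(\<lambda>) = \<Sum>
  \<lambda>\<^sub>i\<^sub>1 (\<lambda>\<^sub>i\<^sub>2 - 1) \<dots> (\<lambda>\<^sub>i\<^sub>k - k
  + 1)\<close>, summed over \<open>i\<^sub>1 \<ge> \<dots> \<ge> i\<^sub>k\<close>, is the shifted
  complete symmetric function of Okounkov and Olshanski. Both sides are determined by removing the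
  cell of the largest entry. Frobenius' product for the number of tableaux gives the share
  \<open>w\<^sub>i / n\<close> of the tableaux whose largest entry is in row \<open>i\<close>, so
  the claim is \<open>\<Sum>\<^sub>i w\<^sub>i h\<^sup>*\<^sub>k(\<lambda> - e\<^sub>i) = (n - k)
  h\<^sup>*\<^sub>k(\<lambda>)\<close> (\<open>hstar_cotransition\<close>). The generating
  function of \<open>h\<^sup>*\<^sub>k(\<lambda>)\<close> over the inverse falling factorials is a
  product over the rows (\<open>hstar_generating\<close>), and for this product the claim is a
  partial fraction expansion whose residues are the numbers \<open>- w\<^sub>i\<close>. The case
  \<open>k = 0\<close>, that is \<open>\<Sum>\<^sub>i w\<^sub>i = n\<close>, proves Frobenius'
  product itself, and with it the hook length formula.\<close>

section \<open>Partial fractions for the Vandermonde quotient\<close>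

text \<open>
  Up to sign the residue of \<open>\<Prod>\<^sub>j (1 - 1 / (z - x\<^sub>j))\<close> at \<open>z =
  x\<^sub>i\<close>. It is also the factor by which the Vandermonde product changes when
  \<open>x\<^sub>i\<close> is lowered by 1.\<close>

definition residue_factor :: "('a \<Rightarrow> real) \<Rightarrow> 'a set \<Rightarrow> 'a \<Rightarrow> real" where
  "residue_factor x S i = (\<Prod>j\<in>S - {i}. 1 - 1 / (x i - x j))"

lemma residue_factor_insert:
  assumes "finite S" "a \<notin> S" "i \<in> S"
  shows "residue_factor x (insert a S) i = residue_factor x S i + residue_factor x S i / (x a - x i)"
proof -
  have "insert a S - {i} = insert a (S - {i})" using assms by auto
  then have "residue_factor x (insert a S) i = (1 - 1 / (x i - x a)) * residue_factor x S i"
    using assms by (simp add: residue_factor_def)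
  also have "1 - 1 / (x i - x a) = 1 + 1 / (x a - x i)"
    by (metis diff_minus_eq_add minus_diff_eq minus_divide_right)
  finally show ?thesis by (simp add: distrib_right)
qed

lemma residue_factor_insert_self:
  assumes "a \<notin> S"
  shows "residue_factor x (insert a S) a = (\<Prod>j\<in>S. 1 - 1 / (x a - x j))"
  using assms by (simp add: residue_factor_def)

lemma divide_divide_split:
  fixes q :: real
  assumes "s \<noteq> 0" "t \<noteq> 0" "s + t \<noteq> 0"
  shows "q / s / (s + t) = q / s / t - q / (s + t) / t"
  using assms by (simp add: divide_simps) (simp add: algebra_simps)

text \<open>
  Adding one node \<open>x\<^sub>a\<close> multiplies the product by \<open>1 - 1 / (z -
  x\<^sub>a)\<close>; the mixed terms \<open>1 / ((z - x\<^sub>a) (z - x\<^sub>i))\<close> split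
  once more, and the induction hypothesis at \<open>z = x\<^sub>a\<close> collects the coefficient
  of \<open>1 / (z - x\<^sub>a)\<close>.\<close>

lemma partial_fractions:
  assumes "finite S" "inj_on x S" "z \<notin> x ` S"
  shows "(\<Prod>i\<in>S. 1 - 1 / (z - x i)) = 1 - (\<Sum>i\<in>S. residue_factor x S i / (z - x i))"
  using assms
proof (induction S arbitrary: z rule: finite_induct)
  case (insert a S)
  let ?q = "residue_factor x S"
  have inj: "inj_on x S" and xa: "x a \<notin> x ` S" using insert by auto
  have za: "z \<noteq> x a" and zS: "z \<notin> x ` S" using insert by auto
  note IHz = insert.IH[OF inj zS] and IHa = insert.IH[OF inj xa]
  have split: "residue_factor x (insert a S) i / (z - x i)
      = ?q i / (z - x i) + (?q i / (x a - x i) / (z - x i))" if "i \<in> S" for i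
    using residue_factor_insert[OF insert(1,2) that, of x] by (simp add: add_divide_distrib)
  have cross: "?q i / (x a - x i) / (z - x i)
      = ?q i / (x a - x i) / (z - x a) - ?q i / (z - x i) / (z - x a)" if "i \<in> S" for i
  proof -
    have "x i \<noteq> x a" "z \<noteq> x i" using imageI[OF that, of x] xa zS by metis+
    then show ?thesis using za divide_divide_split[of "x a - x i" "z - x a" "?q i"] by simp
  qed
  have "(\<Sum>i\<in>insert a S. residue_factor x (insert a S) i / (z - x i))
      = (\<Prod>j\<in>S. 1 - 1 / (x a - x j)) / (z - x a)
        + (\<Sum>i\<in>S. ?q i / (z - x i) + (?q i / (x a - x i) / (z - x a) - ?q i / (z - x i) / (z - x a)))"
    unfolding sum.insert[OF insert(1,2)] residue_factor_insert_self[OF insert(2)]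
    by (intro arg_cong2[where f = "(+)"] sum.cong refl) (simp only: split cross)
  also have "\<dots> = (1 - (\<Sum>i\<in>S. ?q i / (x a - x i))) / (z - x a)
        + ((\<Sum>i\<in>S. ?q i / (z - x i)) + ((\<Sum>i\<in>S. ?q i / (x a - x i)) / (z - x a)
        - (\<Sum>i\<in>S. ?q i / (z - x i)) / (z - x a)))"
    by (simp add: IHa sum.distrib sum_subtractf sum_divide_distrib)
  also have "\<dots> = 1 - (1 - 1 / (z - x a)) * (1 - (\<Sum>i\<in>S. ?q i / (z - x i)))"
    by (simp add: algebra_simps diff_divide_distrib)
  finally show ?case using insert(1,2) by (simp add: IHz)
qed simp

text \<open>
  The first two coefficients of the expansion of \<open>partial_fractions\<close> at \<open>z =
  \<infinity>\<close>, obtained without limits by the same induction on the nodes.\<close>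

lemma residue_factor_sums:
  assumes "finite S" "inj_on x S"
  shows "(\<Sum>i\<in>S. residue_factor x S i) = real (card S)"
    and "(\<Sum>i\<in>S. x i * residue_factor x S i)
       = (\<Sum>i\<in>S. x i) - real (card S) * (real (card S) - 1) / 2"
proof -
  have "(\<Sum>i\<in>S. residue_factor x S i) = real (card S) \<and>
     (\<Sum>i\<in>S. x i * residue_factor x S i)
       = (\<Sum>i\<in>S. x i) - real (card S) * (real (card S) - 1) / 2"
    using assms
  proof (induction S rule: finite_induct)
    case (insert a S)
    let ?q = "residue_factor x S"
    let ?s = "\<Sum>i\<in>S. ?q i / (x a - x i)"
    have inj: "inj_on x S" and xa: "x a \<notin> x ` S" using insert by auto
    note IH = insert.IH[OF inj]
    have self: "residue_factor x (insert a S) a = 1 - ?s"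
      using partial_fractions[OF insert(1) inj xa] insert(2) by (simp add: residue_factor_insert_self)
    have old: "residue_factor x (insert a S) i = ?q i + ?q i / (x a - x i)" if "i \<in> S" for i
      using residue_factor_insert[OF insert(1,2) that] .
    have old': "x i * residue_factor x (insert a S) i
        = x i * ?q i + (x a * (?q i / (x a - x i)) - ?q i)" if "i \<in> S" for i
    proof -
      have "x i \<noteq> x a" using imageI[OF that, of x] xa by metis
      then have "?q i = (x a - x i) * (?q i / (x a - x i))" by simp
      then show ?thesis unfolding old[OF that] by argo
    qed
    have "(\<Sum>i\<in>S. residue_factor x (insert a S) i) = (\<Sum>i\<in>S. ?q i) + ?s"
      by (simp add: old sum.distrib cong: sum.cong)
    moreover have "(\<Sum>i\<in>S. x i * residue_factor x (insert a S) i)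
        = (\<Sum>i\<in>S. x i * ?q i) + (x a * ?s - (\<Sum>i\<in>S. ?q i))"
      by (simp add: old' sum.distrib sum_subtractf sum_distrib_left cong: sum.cong)
    moreover have "real (card (insert a S)) = real (card S) + 1" using insert(1,2) by simp
    ultimately show ?case
      unfolding sum.insert[OF insert(1,2)] self using IH
      by (simp add: algebra_simps add_divide_distrib diff_divide_distrib)
  qed simp
  then show "(\<Sum>i\<in>S. residue_factor x S i) = real (card S)"
    and "(\<Sum>i\<in>S. x i * residue_factor x S i)
       = (\<Sum>i\<in>S. x i) - real (card S) * (real (card S) - 1) / 2" by auto
qed

lemma partial_fractions_times_z:
  assumes "finite S" "inj_on x S" "z \<notin> x ` S"
  shows "(\<Sum>i\<in>S. x i * residue_factor x S i / (z - x i))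
       = z - real (card S) - z * (\<Prod>i\<in>S. 1 - 1 / (z - x i))"
proof -
  have "(\<Sum>i\<in>S. x i * residue_factor x S i / (z - x i))
      = (\<Sum>i\<in>S. z * (residue_factor x S i / (z - x i)) - residue_factor x S i)"
  proof (rule sum.cong)
    fix i assume "i \<in> S"
    then have "z \<noteq> x i" using assms(3) by auto
    then show "x i * residue_factor x S i / (z - x i)
        = z * (residue_factor x S i / (z - x i)) - residue_factor x S i"
      by (simp add: field_simps)
  qed simp
  also have "\<dots> = z * (\<Sum>i\<in>S. residue_factor x S i / (z - x i)) - real (card S)"
    using residue_factor_sums(1)[OF assms(1,2)] by (simp add: sum_subtractf sum_distrib_left)
  finally show ?thesis unfolding partial_fractions[OF assms] by (simp add: algebra_simps)
qed

section \<open>Shapes, corners and the corner weights\<close>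

text \<open>
  The numbers \<open>\<lambda>\<^sub>i + r - i - 1\<close> of Frobenius' formula, for rows counted
  from 0. They are strictly decreasing even when rows are equal or empty.\<close>

definition beta :: "(nat \<Rightarrow> nat) \<Rightarrow> nat \<Rightarrow> nat \<Rightarrow> real" where
  "beta a r i = real (a i) + real r - real i - 1"

lemma beta_less: "antimono a \<Longrightarrow> i < j \<Longrightarrow> beta a r j < beta a r i"
  using antimonoD[of a i j] by (simp add: beta_def)

lemma inj_on_beta: "antimono a \<Longrightarrow> inj_on (beta a r) S"
  by (rule inj_onI) (metis beta_less less_irrefl linorder_neqE_nat)

text \<open>
  For a corner in row \<open>i\<close> this is \<open>n\<close> times the proportion of tableaux
  that have their largest entry there (\<open>card_ballot_words_remove_cell\<close>).\<close>

definition weight :: "(nat \<Rightarrow> nat) \<Rightarrow> nat \<Rightarrow> nat \<Rightarrow> real" where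
  "weight a r i = beta a r i * residue_factor (beta a r) {..<r} i"

definition corner :: "(nat \<Rightarrow> nat) \<Rightarrow> nat \<Rightarrow> bool" where
  "corner a i \<longleftrightarrow> a (Suc i) < a i"

definition remove_cell :: "(nat \<Rightarrow> nat) \<Rightarrow> nat \<Rightarrow> nat \<Rightarrow> nat" where
  "remove_cell a i = a(i := a i - 1)"

text \<open>
  Row lengths as a function on all row indices with \<open>r\<close> a bound for the number of
  nonzero rows. Keeping \<open>r\<close> fixed while cells are removed avoids changing the index
  set when a row becomes empty.\<close>

definition shape :: "(nat \<Rightarrow> nat) \<Rightarrow> nat \<Rightarrow> bool" where
  "shape a r \<longleftrightarrow> antimono a \<and> (\<forall>i\<ge>r. a i = 0)"

lemma corner_less: "shape a r \<Longrightarrow> corner a i \<Longrightarrow> i < r"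
  by (metis corner_def not_less not_less0 shape_def)

lemma shape_remove_cell:
  assumes "shape a r" "corner a i"
  shows "shape (remove_cell a i) r"
proof -
  have "antimono (remove_cell a i)"
    unfolding antimono_iff_le_Suc
  proof
    fix j
    have "a (Suc j) \<le> a j" using assms(1) by (simp add: shape_def antimono_iff_le_Suc)
    then show "remove_cell a i (Suc j) \<le> remove_cell a i j"
      using assms(2) by (auto simp: remove_cell_def corner_def)
  qed
  then show ?thesis using assms(1) by (auto simp: shape_def remove_cell_def)
qed

text \<open>
  A row without a corner has \<open>\<beta>\<^sub>i - 1 = \<beta>\<^sub>i\<^sub>+\<^sub>1\<close>,
  or it is the last row and \<open>\<beta>\<^sub>i = 0\<close>. So sums over the corners extend to
  sums over all rows, which the partial fractions need.\<close>

lemma weight_eq_0: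
  assumes "shape a r" "i < r" "\<not> corner a i"
  shows "weight a r i = 0"
proof -
  have eq: "a (Suc i) = a i"
    using assms antimonoD[of a i "Suc i"] by (simp add: shape_def corner_def)
  show ?thesis
  proof (cases "Suc i = r")
    case True
    then have "a i = 0" using eq assms(1) by (simp add: shape_def)
    then show ?thesis using True by (auto simp: weight_def beta_def)
  next
    case False
    then have "Suc i \<in> {..<r} - {i}" using assms(2) by simp
    moreover have "1 - 1 / (beta a r i - beta a r (Suc i)) = 0" by (simp add: beta_def eq)
    ultimately have "residue_factor (beta a r) {..<r} i = 0"
      unfolding residue_factor_def by (intro prod_zero) auto
    then show ?thesis by (simp add: weight_def)
  qed
qed

text \<open>
  This says that the proportions of tableaux with the largest entry in a given row sum to 1.\<close>

lemma sum_weight: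
  assumes "antimono a"
  shows "(\<Sum>i<r. weight a r i) = (\<Sum>i<r. real (a i))"
proof -
  have "(\<Sum>i<r. weight a r i) = (\<Sum>i<r. beta a r i) - real r * (real r - 1) / 2"
    using residue_factor_sums(2)[OF _ inj_on_beta[OF assms], of "{..<r}" r]
    by (simp add: weight_def)
  moreover have "(\<Sum>i<r. beta a r i) = (\<Sum>i<r. real (a i)) + (\<Sum>i<r. real r - 1 - real i)"
    by (simp add: beta_def sum.distrib[symmetric] algebra_simps)
  moreover have "(\<Sum>i<r. real r - 1 - real i) = real r * (real r - 1) / 2"
  proof (induction r)
    case (Suc r)
    have "(\<Sum>i<Suc r. real (Suc r) - 1 - real i) = (\<Sum>i<r. real r - 1 - real i + 1)"
      by simp
    then show ?case unfolding sum.distrib Suc by (simp add: field_simps)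
  qed simp
  ultimately show ?thesis by simp
qed

section \<open>Shifted complete functions\<close>

definition ffact :: "real \<Rightarrow> nat \<Rightarrow> real" where
  "ffact u k = (\<Prod>t<k. u - real t)"

lemma ffact_0 [simp]: "ffact u 0 = 1"
  by (simp add: ffact_def)

lemma ffact_Suc: "ffact u (Suc k) = ffact u k * (u - real k)"
  by (simp add: ffact_def)

lemma ffact_Suc_left: "ffact u (Suc k) = u * ffact (u - 1) k"
  unfolding ffact_def by (simp only: prod.lessThan_Suc_shift) (simp add: diff_diff_eq)

lemma ffact_pos: "u > real k - 1 \<Longrightarrow> ffact u k > 0"
  unfolding ffact_def by (rule prod_pos) auto

lemma ffact_shift: "ffact (u + 1) k * (u + 1 - real k) = (u + 1) * ffact u k"
  using ffact_Suc[of "u + 1" k] ffact_Suc_left[of "u + 1" k] by simp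

lemma ffact_shift_divide:
  assumes "u > real k - 1"
  shows "(u + 1 - real k) * (y / ffact u k) = (u + 1) * (y / ffact (u + 1) k)"
proof -
  have "ffact u k > 0" "ffact (u + 1) k > 0" using assms by (auto intro!: ffact_pos)
  then have "(u + 1 - real k) / ffact u k = (u + 1) / ffact (u + 1) k"
    using ffact_shift[of u k] by (simp add: frac_eq_eq mult.commute)
  then have "y * ((u + 1 - real k) / ffact u k) = y * ((u + 1) / ffact (u + 1) k)" by (rule arg_cong)
  then show ?thesis by (simp add: mult.commute)
qed

text \<open>
  For \<open>u \<rightarrow> \<infinity>\<close> only the term \<open>k = 0\<close> survives, so
  its coefficient vanishes; the other terms have the common factor \<open>1 / u\<close>, and the
  quotient is a sum of the same kind in \<open>u - 1\<close>.\<close>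

lemma inverse_ffact_independent:
  fixes c :: "nat \<Rightarrow> real"
  assumes "\<And>u. u > B \<Longrightarrow> (\<Sum>k<K. c k / ffact u k) = 0" and "k < K"
  shows "c k = 0"
  using assms
proof (induction K arbitrary: c k B)
  case 0
  then show ?case by simp
next
  case (Suc K)
  have lim: "((\<lambda>u. \<Sum>k<Suc K. c k / ffact u k) \<longlongrightarrow> (\<Sum>k<Suc K. if k = 0 then c 0 else 0)) at_top"
  proof (rule tendsto_sum)
    fix k
    show "((\<lambda>u. c k / ffact u k) \<longlongrightarrow> (if k = 0 then c 0 else 0)) at_top"
    proof (cases k)
      case (Suc m)
      have ge1: "ffact u j \<ge> 1" if "u > real j" for u j
        unfolding ffact_def using that by (intro prod_ge_1) auto
      have "filterlim (\<lambda>u. ffact u (Suc m)) at_top at_top"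
      proof (rule filterlim_at_top_mono[where f = "\<lambda>u. u"])
        show "\<forall>\<^sub>F u in at_top. u \<le> ffact u (Suc m)"
          using eventually_gt_at_top[of "real (Suc m)"]
        proof eventually_elim
          case (elim u)
          then show ?case using ge1[of m "u - 1"]
            by (simp add: ffact_Suc_left)
        qed
      qed (simp add: filterlim_ident)
      then have "((\<lambda>u. c k / ffact u (Suc m)) \<longlongrightarrow> 0) at_top"
        by (intro tendsto_divide_0[OF tendsto_const] filterlim_at_top_imp_at_infinity)
      then show ?thesis using Suc by simp
    qed simp
  qed
  have "((\<lambda>u. \<Sum>k<Suc K. c k / ffact u k) \<longlongrightarrow> 0) at_top"
    by (rule tendsto_eventually, rule eventually_mono[OF eventually_gt_at_top[of B]])
       (use Suc.prems(1) in auto)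
  then have "(\<Sum>k<Suc K. if k = 0 then c 0 else 0) = 0"
    using lim tendsto_unique trivial_limit_at_top_linorder by blast
  then have c0: "c 0 = 0" by (simp split: if_splits)
  have tail: "c (Suc j) = 0" if "j < K" for j
  proof (rule Suc.IH[of "max B 0" "\<lambda>j. c (Suc j)", OF _ that])
    fix u assume u: "u > max B 0"
    have "0 = (\<Sum>k<Suc K. c k / ffact (u + 1) k)"
      using Suc.prems(1)[of "u + 1"] u by simp
    also have "\<dots> = (\<Sum>k<K. c (Suc k) / ffact (u + 1) (Suc k))"
      by (simp only: sum.lessThan_Suc_shift) (simp add: c0)
    also have "\<dots> = (\<Sum>k<K. c (Suc k) / ffact u k) / (u + 1)"
      by (simp add: ffact_Suc_left sum_divide_distrib mult.commute)
    finally show "(\<Sum>k<K. c (Suc k) / ffact u k) = 0" using u by simp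
  qed
  show ?case using c0 tail Suc.prems(2) by (cases k) auto
qed

text \<open>
  The shifted complete symmetric function of the rows \<open>p, \<dots>, r - 1\<close>: the sum of
  \<open>(x\<^sub>q\<^sub>1 - k + 1) (x\<^sub>q\<^sub>2 - k + 2) \<dots> x\<^sub>q\<^sub>k\<close>
  over \<open>p \<le> q\<^sub>1 \<le> \<dots> \<le> q\<^sub>k < r\<close>.\<close>

primrec hstar :: "(nat \<Rightarrow> real) \<Rightarrow> nat \<Rightarrow> nat \<Rightarrow> nat \<Rightarrow> real" where
  "hstar x r 0 p = 1"
| "hstar x r (Suc k) p = (\<Sum>q=p..<r. (x q - real k) * hstar x r k q)"

text \<open>
  Sort the index sequences by whether the smallest index is the first row.\<close>

lemma hstar_row:
  "p < r \<Longrightarrow> hstar x r (Suc k) p = (x p - real k) * hstar x r k p + hstar x r (Suc k) (Suc p)"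
  by (simp add: sum.atLeast_Suc_lessThan)

lemma hstar_beyond: "r \<le> p \<Longrightarrow> hstar x r k p = (if k = 0 then 1 else 0)"
  by (cases k) auto

text \<open>
  This makes the generating function a finite sum. It fails for general arguments: it uses that
  the row lengths are integers, so that the factor \<open>a\<^sub>p - k\<close> vanishes at the
  right moment.\<close>

lemma hstar_eq_0:
  fixes a :: "nat \<Rightarrow> nat"
  assumes "antimono a" "a p < k"
  shows "hstar (\<lambda>i. real (a i)) r k p = 0"
  using assms(2)
proof (induction "r - p" arbitrary: p k)
  case 0
  then show ?case by (simp add: hstar_beyond)
next
  case (Suc d)
  note below = Suc.hyps(1)
  have pr: "p < r" using Suc(2) by simp
  have next_row: "hstar (\<lambda>i. real (a i)) r j (Suc p) = 0" if "a p < j" for j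
  proof (rule below)
    show "d = r - Suc p" using Suc.hyps(2) by simp
    show "a (Suc p) < j" using antimonoD[OF assms(1), of p "Suc p"] that by simp
  qed
  have "a p < j \<Longrightarrow> hstar (\<lambda>i. real (a i)) r j p = 0" for j
  proof (induction j)
    case (Suc j)
    have "(real (a p) - real j) * hstar (\<lambda>i. real (a i)) r j p = 0"
      using Suc by (cases "a p = j") auto
    then show ?case using hstar_row[OF pr] next_row[OF Suc.prems] by simp
  qed simp
  then show ?case using Suc.prems by simp
qed

text \<open>
  By \<open>hstar_row\<close> the left side telescopes, apart from the last term.\<close>

lemma hstar_generating_step:
  assumes "p < r" "u > real K"
  shows "(\<Sum>k<Suc K. (u + 1 - real k) * hstar x r k (Suc p) / ffact u k)
    = (u + 1 - x p) * (\<Sum>k<Suc K. hstar x r k p / ffact u k)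
      + (x p - real K) * hstar x r K p / ffact u K"
  using assms(2)
proof (induction K)
  case 0
  then show ?case by simp
next
  case (Suc K)
  have pos: "ffact u K > 0" "u - real K > 0" using Suc.prems ffact_pos[of K u] by auto
  have below: "hstar x r (Suc K) (Suc p) = hstar x r (Suc K) p - (x p - real K) * hstar x r K p"
    using hstar_row[OF assms(1), of x K] by simp
  have cancel: "(u + 1 - real (Suc K)) * y / ffact u (Suc K) = y / ffact u K" for y
    using pos by (simp add: ffact_Suc)
  have "(u + 1 - real (Suc K)) * hstar x r (Suc K) (Suc p) / ffact u (Suc K)
     = (u + 1 - real (Suc K)) * hstar x r (Suc K) p / ffact u (Suc K)
       - (x p - real K) * hstar x r K p / ffact u K"
    unfolding below right_diff_distrib diff_divide_distrib cancel ..
  moreover have "(u + 1 - real (Suc K)) * hstar x r (Suc K) p / ffact u (Suc K)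
     = (u + 1 - x p) * (hstar x r (Suc K) p / ffact u (Suc K))
       + (x p - real (Suc K)) * hstar x r (Suc K) p / ffact u (Suc K)"
    by (simp add: add_divide_distrib[symmetric] distrib_right[symmetric])
  moreover have "(\<Sum>k<Suc K. (u + 1 - real k) * hstar x r k (Suc p) / ffact u k)
    = (u + 1 - x p) * (\<Sum>k<Suc K. hstar x r k p / ffact u k)
      + (x p - real K) * hstar x r K p / ffact u K"
    using Suc by simp
  ultimately show ?case
    unfolding sum.lessThan_Suc[of _ "Suc K"] distrib_left by simp
qed

text \<open>
  \<open>\<Sum>\<^sub>k h\<^sup>*\<^sub>k / (u (u - 1) \<dots> (u - k + 1))\<close> is a product
  over the rows: adding a row on top multiplies the series for \<open>u + 1\<close> by \<open>(u +
  1) / (u + 1 - a\<^sub>p)\<close>.\<close>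

lemma hstar_generating:
  fixes a :: "nat \<Rightarrow> nat"
  assumes "antimono a" "a 0 < K" "u > real K" "p \<le> r"
  shows "(\<Sum>k<Suc K. hstar (\<lambda>i. real (a i)) r k p / ffact u k)
    = (\<Prod>q=p..<r. (u + real q - real p + 1) / (u + real q - real p + 1 - real (a q)))"
  using assms(3,4)
proof (induction "r - p" arbitrary: p u)
  case 0
  then have "(\<Sum>k<Suc K. hstar (\<lambda>i. real (a i)) r k p / ffact u k) = (\<Sum>k<Suc K. if k = 0 then 1 else 0)"
    by (intro sum.cong refl) (simp add: hstar_beyond)
  then show ?case using 0 by simp
next
  case (Suc d)
  let ?h = "hstar (\<lambda>i. real (a i)) r"
  have pr: "p < r" using Suc(2) by simp
  have ap: "a p < K" using antimonoD[OF assms(1), of 0 p] assms(2) by simp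
  have ne: "u + 1 - real (a p) \<noteq> 0" using ap Suc.prems(1) by simp
  have top: "?h K p = 0" by (rule hstar_eq_0[OF assms(1) ap])
  have shift: "(u + 1 - real k) * y / ffact u k = (u + 1) * (y / ffact (u + 1) k)"
    if "k < Suc K" for k y
    using ffact_shift_divide[of k u y] that Suc.prems(1) by simp
  have "(u + 1 - real (a p)) * (\<Sum>k<Suc K. ?h k p / ffact u k)
      = (\<Sum>k<Suc K. (u + 1 - real k) * ?h k (Suc p) / ffact u k)"
    using hstar_generating_step[OF pr Suc.prems(1), of "\<lambda>i. real (a i)"] top by simp
  also have "\<dots> = (u + 1) * (\<Sum>k<Suc K. ?h k (Suc p) / ffact (u + 1) k)"
    unfolding sum_distrib_left by (intro sum.cong refl shift) simp
  also have "(\<Sum>k<Suc K. ?h k (Suc p) / ffact (u + 1) k) = (\<Prod>q=Suc p..<r.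
       (u + 1 + real q - real (Suc p) + 1) / (u + 1 + real q - real (Suc p) + 1 - real (a q)))"
    by (rule Suc.hyps(1)) (use Suc in auto)
  also have "\<dots> = (\<Prod>q=Suc p..<r. (u + real q - real p + 1) / (u + real q - real p + 1 - real (a q)))"
    by (simp add: add_diff_eq)
  finally have "(\<Sum>k<Suc K. ?h k p / ffact u k) = (u + 1) / (u + 1 - real (a p)) *
     (\<Prod>q=Suc p..<r. (u + real q - real p + 1) / (u + real q - real p + 1 - real (a q)))"
    using ne by (simp add: field_simps)
  then show ?case using pr by (simp add: prod.atLeast_Suc_lessThan)
qed

text \<open>
  Removing a cell of row \<open>i\<close> changes one factor of the product, by the factor
  \<open>1 - 1 / (z - \<beta>\<^sub>i)\<close> with \<open>z = u + r + 1\<close>.\<close>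

lemma prod_remove_cell_ratio:
  fixes u :: real
  assumes "shape a r" "corner a i" "u > real (a 0)"
  shows "(\<Prod>q=0..<r. (u + real q + 1) / (u + real q + 1 - real (remove_cell a i q)))
    = (\<Prod>q=0..<r. (u + real q + 1) / (u + real q + 1 - real (a q)))
      * (1 - 1 / (u + real r + 1 - beta a r i))"
proof -
  have ir: "i \<in> {0..<r}" and ai: "a i > 0"
    using corner_less[OF assms(1,2)] assms(2) by (auto simp: corner_def)
  have le: "a i \<le> a 0" using assms(1) antimonoD[of a 0 i] by (simp add: shape_def)
  have removed: "(\<Prod>q=0..<r. (u + real q + 1) / (u + real q + 1 - real (remove_cell a i q)))
     = (u + real i + 1) / (u + real i + 1 - (real (a i) - 1))
       * (\<Prod>q\<in>{0..<r} - {i}. (u + real q + 1) / (u + real q + 1 - real (a q)))"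
    using ai by (subst prod.remove[OF _ ir]) (auto simp: remove_cell_def of_nat_diff)
  have full: "(\<Prod>q=0..<r. (u + real q + 1) / (u + real q + 1 - real (a q)))
     = (u + real i + 1) / (u + real i + 1 - real (a i))
       * (\<Prod>q\<in>{0..<r} - {i}. (u + real q + 1) / (u + real q + 1 - real (a q)))"
    by (subst prod.remove[OF _ ir]) auto
  have factor: "(u + real i + 1) / (u + real i + 1 - (real (a i) - 1))
     = (u + real i + 1) / (u + real i + 1 - real (a i)) * (1 - 1 / (u + real r + 1 - beta a r i))"
  proof -
    \<comment> \<open>\<open>D\<close> is the old denominator; it grows by 1 when the row loses a cell.\<close>
    have ratio: "N / (D + 1) = N / D * (1 - 1 / (D + 1))" if "D > 0" for N D :: real
      using that by (simp add: field_simps)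
    have "u + real i + 1 - real (a i) > 0" using le assms(3) by simp
    from ratio[OF this, of "u + real i + 1"] show ?thesis by (simp add: beta_def algebra_simps)
  qed
  show ?thesis unfolding removed full factor by simp
qed

text \<open>
  Shifting \<open>u\<close> changes every denominator; the numerators telescope, which leaves the
  product that \<open>partial_fractions\<close> expands.\<close>

lemma prod_shift_ratio:
  fixes u :: real
  assumes "shape a r" "u > real (a 0)"
  shows "(u + 1) * (\<Prod>q=0..<r. (u + 1 + real q + 1) / (u + 1 + real q + 1 - real (a q)))
    = (u + real r + 1) * (\<Prod>i<r. 1 - 1 / (u + real r + 1 - beta a r i))
      * (\<Prod>q=0..<r. (u + real q + 1) / (u + real q + 1 - real (a q)))"
proof -
  have "(u + 1) * (\<Prod>q=0..<m. (u + 1 + real q + 1) / (u + 1 + real q + 1 - real (a q)))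
    = (u + real m + 1) * (\<Prod>i<m. 1 - 1 / (u + real r + 1 - beta a r i))
      * (\<Prod>q=0..<m. (u + real q + 1) / (u + real q + 1 - real (a q)))" for m
  proof (induction m)
    case (Suc m)
    have "a m \<le> a 0" using assms(1) antimonoD[of a 0 m] by (simp add: shape_def)
    then have d: "u + real m + 1 - real (a m) > 0" using assms(2) by simp
    have "u + real m + 1 > 0" using assms(2) by simp
    then have f: "(u + real m + 1) * ((u + 1 + real m + 1) / (u + 1 + real m + 1 - real (a m)))
        = (u + real (Suc m) + 1) * (1 - 1 / (u + real r + 1 - beta a r m))
          * ((u + real m + 1) / (u + real m + 1 - real (a m)))"
      using d by (simp add: beta_def divide_simps) (simp add: algebra_simps)
    have regroup: "(A::real) * B * C * D = (A * D) * (B * C)" for A B C D by simp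
    show ?case
      unfolding prod.atLeast0_lessThan_Suc prod.lessThan_Suc mult.assoc[symmetric] Suc
      unfolding regroup f by simp
  qed simp
  then show ?thesis .
qed

text \<open>
  Divided by \<open>G a u\<close>, this is \<open>partial_fractions_times_z\<close> at \<open>z =
  u + r + 1\<close>.\<close>

lemma hstar_cotransition_generating:
  assumes "shape a r" "a 0 < K" "u > real K"
  defines "n \<equiv> (\<Sum>i<r. real (a i))"
  defines "G \<equiv> (\<lambda>b u. \<Sum>k<Suc K. hstar (\<lambda>i. real (b i)) r k 0 / ffact u k)"
  shows "(\<Sum>i | i < r \<and> corner a i. weight a r i * G (remove_cell a i) u)
    = (u + 1) * G a (u + 1) + (n - u - 1) * G a u"
proof -
  let ?z = "u + real r + 1"
  have anti: "antimono a" using assms(1) by (simp add: shape_def)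
  have u: "u > real (a 0)" using assms(2,3) by simp
  have GQ: "G b v = (\<Prod>q=0..<r. (v + real q + 1) / (v + real q + 1 - real (b q)))"
    if "shape b r" "b 0 < K" "v > real K" for b v
    unfolding G_def using hstar_generating[of b K v 0 r] that by (simp add: shape_def)
  have zb: "?z \<notin> beta a r ` {..<r}"
  proof
    assume "?z \<in> beta a r ` {..<r}"
    then obtain i where "?z = beta a r i" by auto
    moreover have "a i \<le> a 0" using antimonoD[OF anti, of 0 i] by simp
    ultimately show False using u by (simp add: beta_def)
  qed
  have "G (remove_cell a i) u = G a u * (1 - 1 / (?z - beta a r i))" if "corner a i" for i
  proof -
    have "remove_cell a i 0 < K" using assms(2) by (auto simp: remove_cell_def)
    then show ?thesis
      using GQ[OF shape_remove_cell[OF assms(1) that]] GQ[OF assms(1,2,3)] assms(3)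
        prod_remove_cell_ratio[OF assms(1) that u] by simp
  qed
  then have "(\<Sum>i | i < r \<and> corner a i. weight a r i * G (remove_cell a i) u)
      = (\<Sum>i | i < r \<and> corner a i. weight a r i * (G a u * (1 - 1 / (?z - beta a r i))))"
    by simp
  also have "\<dots> = (\<Sum>i<r. weight a r i * (G a u * (1 - 1 / (?z - beta a r i))))"
    by (rule sum.mono_neutral_left) (auto simp: weight_eq_0[OF assms(1)])
  also have "\<dots> = G a u * (\<Sum>i<r. weight a r i - weight a r i / (?z - beta a r i))"
    unfolding sum_distrib_left by (intro sum.cong refl) (simp add: algebra_simps)
  also have "(\<Sum>i<r. weight a r i - weight a r i / (?z - beta a r i))
      = n - (?z - real r - ?z * (\<Prod>i<r. 1 - 1 / (?z - beta a r i)))"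
    using sum_weight[OF anti, of r] partial_fractions_times_z[OF _ inj_on_beta[OF anti] zb]
    by (simp add: sum_subtractf weight_def n_def)
  also have "G a u * \<dots> = ?z * (\<Prod>i<r. 1 - 1 / (?z - beta a r i)) * G a u + (n - u - 1) * G a u"
    by (simp add: algebra_simps)
  also have "?z * (\<Prod>i<r. 1 - 1 / (?z - beta a r i)) * G a u = (u + 1) * G a (u + 1)"
    using prod_shift_ratio[OF assms(1) u] GQ[OF assms(1,2), of u] GQ[OF assms(1,2), of "u + 1"] assms(3)
    by simp
  finally show ?thesis .
qed

text \<open>
  Averaged over the corners, weighted by the share of tableaux with their largest entry there,
  \<open>h\<^sup>*\<^sub>k\<close> divided by the \<open>k\<close>-th falling factorial of the
  number of cells is preserved. On the level of generating functions, multiplication of the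
  coefficients by \<open>n - k\<close> is the operator \<open>G(u) \<mapsto> (u + 1) G(u + 1) + (n
  - u - 1) G(u)\<close>.\<close>

lemma hstar_cotransition:
  assumes "shape a r"
  shows "(\<Sum>i | i < r \<and> corner a i. weight a r i * hstar (\<lambda>j. real (remove_cell a i j)) r k 0)
    = ((\<Sum>i<r. real (a i)) - real k) * hstar (\<lambda>i. real (a i)) r k 0"
proof -
  define n where "n = (\<Sum>i<r. real (a i))"
  \<comment> \<open>Large enough to include the index \<open>k\<close> and to contain all nonzero terms.\<close>
  define K where "K = Suc (max k (a 0))"
  let ?C = "{i. i < r \<and> corner a i}"
  let ?h = "\<lambda>b k. hstar (\<lambda>j. real (b j)) r k 0"
  define c where "c k = (\<Sum>i\<in>?C. weight a r i * ?h (remove_cell a i) k) - (n - real k) * ?h a k" for k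
  have "c k = 0"
  proof (rule inverse_ffact_independent)
    show "k < Suc K" by (simp add: K_def)
    fix u :: real assume u: "u > real K"
    have shift: "(n - real k) * y / ffact u k
        = (u + 1) * (y / ffact (u + 1) k) + (n - u - 1) * (y / ffact u k)" if "k < Suc K" for k y
    proof -
      have "(u + 1) * (y / ffact (u + 1) k) = (u + 1 - real k) * (y / ffact u k)"
        using ffact_shift_divide[of k u y] that u by simp
      then show ?thesis by (simp only: distrib_right[symmetric]) simp
    qed
    have "(\<Sum>k<Suc K. c k / ffact u k)
       = (\<Sum>k<Suc K. (\<Sum>i\<in>?C. weight a r i * (?h (remove_cell a i) k / ffact u k)))
         - (\<Sum>k<Suc K. (n - real k) * ?h a k / ffact u k)"
      by (simp only: c_def diff_divide_distrib sum_subtractf sum_divide_distrib times_divide_eq_right)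
    also have "(\<Sum>k<Suc K. (\<Sum>i\<in>?C. weight a r i * (?h (remove_cell a i) k / ffact u k)))
       = (\<Sum>i\<in>?C. weight a r i * (\<Sum>k<Suc K. ?h (remove_cell a i) k / ffact u k))"
      unfolding sum_distrib_left by (rule sum.swap)
    also have "\<dots> = (u + 1) * (\<Sum>k<Suc K. ?h a k / ffact (u + 1) k)
         + (n - u - 1) * (\<Sum>k<Suc K. ?h a k / ffact u k)"
      unfolding n_def by (rule hstar_cotransition_generating[OF assms _ u]) (simp add: K_def)
    also have "\<dots> = (\<Sum>k<Suc K. (n - real k) * ?h a k / ffact u k)"
      unfolding sum_distrib_left sum.distrib[symmetric]
      by (intro sum.cong refl shift[symmetric]) simp
    finally show "(\<Sum>k<Suc K. c k / ffact u k) = 0" by simp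
  qed
  then show ?thesis by (simp add: c_def n_def)
qed

section \<open>Counting ballot words\<close>

definition dominant :: "nat list \<Rightarrow> bool" where
  "dominant u \<longleftrightarrow> (\<forall>j. count_list u (Suc j) \<le> count_list u j)"

definition ballot :: "nat list \<Rightarrow> bool" where
  "ballot w \<longleftrightarrow> (\<forall>m. dominant (take m w))"

text \<open>
  Letters are row indices counted from 0; the content \<open>a\<close> gives the row lengths.\<close>

definition ballot_words :: "(nat \<Rightarrow> nat) \<Rightarrow> nat list set" where
  "ballot_words a = {w. ballot w \<and> count_list w = a}"

lemma dominant_iff_antimono: "dominant u \<longleftrightarrow> antimono (count_list u)"
  by (simp add: dominant_def antimono_iff_le_Suc)

lemma ballot_dominant: "ballot w \<Longrightarrow> dominant w"
  unfolding ballot_def by (metis take_all order_refl)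

lemma ballot_snoc: "ballot (v @ [i]) \<longleftrightarrow> ballot v \<and> dominant (v @ [i])"
proof
  assume b: "ballot (v @ [i])"
  have "dominant (take m v)" for m
    using b[unfolded ballot_def, rule_format, of "min m (length v)"] by (cases "m \<le> length v") auto
  then show "ballot v \<and> dominant (v @ [i])" using ballot_dominant[OF b] by (simp add: ballot_def)
next
  assume a: "ballot v \<and> dominant (v @ [i])"
  then show "ballot (v @ [i])" unfolding ballot_def
  proof (intro allI)
    fix m show "dominant (take m (v @ [i]))"
      using a by (cases "m \<le> length v") (auto simp: ballot_def)
  qed
qed

lemma count_list_snoc: "count_list (v @ [i]) = (count_list v)(i := Suc (count_list v i))"
  by (auto simp: fun_eq_iff)

lemma count_list_replicate: "count_list (replicate m x) y = (if x = y then m else 0)"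
  by (induction m) auto

lemma length_ballot_word:
  fixes a :: "nat \<Rightarrow> nat"
  assumes "\<forall>i\<ge>r. a i = 0" "count_list w = a"
  shows "set w \<subseteq> {..<r}" "length w = (\<Sum>i<r. a i)"
proof -
  show *: "set w \<subseteq> {..<r}"
  proof
    fix i assume "i \<in> set w"
    then have "a i \<noteq> 0" using assms(2) count_list_0_iff by metis
    then show "i \<in> {..<r}" using assms(1) by (metis lessThan_iff not_le)
  qed
  show "length w = (\<Sum>i<r. a i)" using sum_count_set[OF * finite_lessThan] assms(2) by simp
qed

lemma finite_ballot_words:
  assumes "\<forall>i\<ge>r. a i = 0"
  shows "finite (ballot_words a)"
  by (rule finite_subset[OF _ finite_lists_length_eq[of "{..<r}" "\<Sum>i<r. a i"]])
     (use length_ballot_word[OF assms] in \<open>auto simp: ballot_words_def\<close>)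

text \<open>
  The last letter of a word is the row of the largest entry, which is a corner. A condition on the
  first \<open>k\<close> letters survives the removal as long as another letter remains.\<close>

lemma ballot_words_recursion:
  assumes "shape a r" "k < (\<Sum>i<r. a i)"
  shows "{w \<in> ballot_words a. P (take k w)}
    = (\<Union>i\<in>{i. i < r \<and> corner a i}. (\<lambda>v. v @ [i]) ` {v \<in> ballot_words (remove_cell a i). P (take k v)})"
    (is "?L = ?R")
proof (rule set_eqI)
  fix w
  have supp: "\<forall>i\<ge>r. a i = 0" and anti: "antimono a" using assms(1) by (auto simp: shape_def)
  show "w \<in> ?L \<longleftrightarrow> w \<in> ?R"
  proof
    assume w: "w \<in> ?L"
    then have len: "length w = (\<Sum>i<r. a i)" and cw: "count_list w = a"
      using length_ballot_word(2)[OF supp] by (auto simp: ballot_words_def)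
    then have "w \<noteq> []" using assms(2) by auto
    then obtain v i where wv: "w = v @ [i]" by (metis rev_exhaust)
    have av: "a = (count_list v)(i := Suc (count_list v i))" using cw wv count_list_snoc by metis
    then have cv: "count_list v = remove_cell a i" by (auto simp: remove_cell_def)
    have bv: "ballot v" using w wv ballot_snoc by (simp add: ballot_words_def)
    have "count_list v (Suc i) \<le> count_list v i"
      using ballot_dominant[OF bv] by (simp add: dominant_def)
    then have ci: "corner a i" using av by (simp add: corner_def)
    have "k \<le> length v" using len assms(2) wv by simp
    then show "w \<in> ?R" using w wv bv cv ci corner_less[OF assms(1) ci]
      by (auto simp: ballot_words_def)
  next
    assume "w \<in> ?R"
    then obtain i v where i: "corner a i" and wv: "w = v @ [i]"
      and v: "v \<in> ballot_words (remove_cell a i)" and P: "P (take k v)" by auto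
    have cv: "count_list v = remove_cell a i" and bv: "ballot v" using v by (auto simp: ballot_words_def)
    have cw: "count_list w = a" using i wv cv count_list_snoc[of v i]
      by (auto simp: remove_cell_def corner_def)
    then have "dominant w" using anti by (simp add: dominant_iff_antimono)
    then have "ballot w" using bv wv ballot_snoc by simp
    moreover have "k \<le> length v" using length_ballot_word(2)[OF supp cw] assms(2) wv by simp
    ultimately show "w \<in> ?L" using cw P wv by (simp add: ballot_words_def)
  qed
qed

lemma card_ballot_words_recursion:
  assumes "shape a r" "k < (\<Sum>i<r. a i)"
  shows "card {w \<in> ballot_words a. P (take k w)}
    = (\<Sum>i | i < r \<and> corner a i. card {v \<in> ballot_words (remove_cell a i). P (take k v)})"
proof -
  have "finite (ballot_words (remove_cell a i))" if "corner a i" for i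
    using shape_remove_cell[OF assms(1) that] by (intro finite_ballot_words) (auto simp: shape_def)
  then have "card {w \<in> ballot_words a. P (take k w)}
    = (\<Sum>i | i < r \<and> corner a i. card ((\<lambda>v. v @ [i]) ` {v \<in> ballot_words (remove_cell a i). P (take k v)}))"
    unfolding ballot_words_recursion[OF assms] by (intro card_UN_disjoint) auto
  also have "\<dots> = (\<Sum>i | i < r \<and> corner a i. card {v \<in> ballot_words (remove_cell a i). P (take k v)})"
    by (intro sum.cong refl card_image) (auto simp: inj_on_def)
  finally show ?thesis .
qed

lemma sum_remove_cell:
  assumes "shape a r" "corner a i"
  shows "Suc (\<Sum>j<r. remove_cell a i j) = (\<Sum>j<r. a j)"
proof -
  have i: "i \<in> {..<r}" using corner_less[OF assms] by simp
  have "(\<Sum>j<r. remove_cell a i j) = (a i - 1) + (\<Sum>j\<in>{..<r} - {i}. a j)"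
    by (subst sum.remove[OF _ i]) (auto simp: remove_cell_def)
  moreover have "(\<Sum>j<r. a j) = a i + (\<Sum>j\<in>{..<r} - {i}. a j)"
    by (subst sum.remove[OF _ i]) auto
  ultimately show ?thesis using assms(2) by (simp add: corner_def)
qed

text \<open>
  Frobenius' product \<open>\<Prod>\<^sub>i\<^sub><\<^sub>j (\<beta>\<^sub>i - \<beta>\<^sub>j) /
  \<Prod>\<^sub>i \<beta>\<^sub>i!\<close>, grouped by rows so that each factor can be compared
  with the hooks of one row.\<close>

definition frobenius :: "(nat \<Rightarrow> nat) \<Rightarrow> nat \<Rightarrow> real" where
  "frobenius a r = (\<Prod>i<r. (\<Prod>j\<in>{i<..<r}. beta a r i - beta a r j) / fact (a i + (r - Suc i)))"

text \<open>
  Only the pairs that contain \<open>p\<close> change. They correspond to the other indices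
  \<open>j\<close> by \<open>j \<mapsto> (min j p, max j p)\<close>, and the signs of the two
  orders cancel in the quotient.\<close>

lemma vandermonde_decrement:
  fixes x :: "nat \<Rightarrow> real"
  assumes "p < r" "inj_on x {..<r}"
  defines "y \<equiv> x(p := x p - 1)"
  shows "(\<Prod>i<r. \<Prod>j\<in>{i<..<r}. y i - y j)
    = (\<Prod>i<r. \<Prod>j\<in>{i<..<r}. x i - x j) * residue_factor x {..<r} p"
proof -
  let ?P = "Sigma {..<r} (\<lambda>i. {i<..<r})"
  let ?\<rho> = "\<lambda>(i, j). (y i - y j) / (x i - x j)"
  \<comment> \<open>The pair formed by \<open>j\<close> and \<open>p\<close> in increasing order.\<close>
  let ?g = "\<lambda>j. (min j p, max j p)"
  have ne: "x i - x j \<noteq> 0" if "i < r" "j < r" "i \<noteq> j" for i j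
    using assms(2) that by (auto simp: inj_on_def)
  have inj: "inj_on ?g ({..<r} - {p})"
    by (rule inj_onI) (auto simp: min_def max_def split: if_splits)
  have "(\<Prod>z\<in>?P. ?\<rho> z) = (\<Prod>z\<in>?g ` ({..<r} - {p}). ?\<rho> z)"
  proof (rule prod.mono_neutral_right)
    show "?g ` ({..<r} - {p}) \<subseteq> ?P" using assms(1) by (auto simp: min_def max_def)
    show "\<forall>z\<in>?P - ?g ` ({..<r} - {p}). ?\<rho> z = 1"
    proof
      fix z assume z: "z \<in> ?P - ?g ` ({..<r} - {p})"
      then obtain i j where zij: "z = (i, j)" and ij: "i \<in> {..<r}" "j \<in> {i<..<r}" by auto
      have no: "(i, j) \<notin> ?g ` ({..<r} - {p})" using z zij by simp
      have "i \<noteq> p"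
      proof
        assume "i = p"
        then have "(i, j) = ?g j" "j \<in> {..<r} - {p}" using ij by auto
        then show False using no by blast
      qed
      moreover have "j \<noteq> p"
      proof
        assume "j = p"
        then have "(i, j) = ?g i" "i \<in> {..<r} - {p}" using ij by auto
        then show False using no by blast
      qed
      moreover have "x i - x j \<noteq> 0" using ij by (intro ne) auto
      ultimately show "?\<rho> z = 1" by (simp add: y_def zij)
    qed
  qed auto
  also have "\<dots> = (\<Prod>j\<in>{..<r} - {p}. ?\<rho> (?g j))"
    by (simp only: prod.reindex[OF inj] o_def)
  also have "\<dots> = residue_factor x {..<r} p"
    unfolding residue_factor_def
  proof (rule prod.cong)
    fix j assume j: "j \<in> {..<r} - {p}"
    then have d: "x p - x j \<noteq> 0" "x j - x p \<noteq> 0"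
      using assms(1) ne[of p j] ne[of j p] by auto
    show "?\<rho> (?g j) = 1 - 1 / (x p - x j)"
    proof (cases "j < p")
      case True
      then show ?thesis using d by (simp add: y_def min_def max_def field_simps)
    next
      case False
      then show ?thesis using d j by (simp add: y_def min_def max_def field_simps)
    qed
  qed simp
  finally have ratio: "(\<Prod>z\<in>?P. ?\<rho> z) = residue_factor x {..<r} p" .
  have "(\<Prod>(i, j)\<in>?P. y i - y j) = (\<Prod>z\<in>?P. (\<lambda>(i, j). x i - x j) z * ?\<rho> z)"
  proof (rule prod.cong)
    fix z assume "z \<in> ?P"
    then obtain i j where "z = (i, j)" "i < r" "j < r" "i \<noteq> j" by auto
    then show "(\<lambda>(i, j). y i - y j) z = (\<lambda>(i, j). x i - x j) z * ?\<rho> z" using ne[of i j] by simp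
  qed simp
  then show ?thesis using ratio by (simp add: prod.distrib prod.Sigma)
qed

lemma frobenius_remove_cell:
  assumes "shape a r" "corner a p"
  shows "frobenius (remove_cell a p) r = frobenius a r * weight a r p"
proof -
  have p: "p < r" "p \<in> {..<r}" and ap: "a p > 0"
    using corner_less[OF assms] assms(2) by (auto simp: corner_def)
  have anti: "antimono a" using assms(1) by (simp add: shape_def)
  have b: "beta (remove_cell a p) r = (beta a r)(p := beta a r p - 1)"
    using ap by (auto simp: fun_eq_iff beta_def remove_cell_def of_nat_diff)
  have "(\<Prod>i<r. fact (a i + (r - Suc i)) :: real) = fact (a p + (r - Suc p))
      * (\<Prod>i\<in>{..<r} - {p}. fact (a i + (r - Suc i)))"
    by (subst prod.remove[OF _ p(2)]) auto
  also have "(fact (a p + (r - Suc p)) :: real) = beta a r p * fact (a p - 1 + (r - Suc p))"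
  proof -
    have "a p + (r - Suc p) = Suc (a p - 1 + (r - Suc p))" using ap by simp
    then have "(fact (a p + (r - Suc p)) :: real) = real (a p + (r - Suc p)) * fact (a p - 1 + (r - Suc p))"
      by (metis fact_Suc)
    moreover have "real (a p + (r - Suc p)) = beta a r p" using p by (simp add: beta_def of_nat_diff)
    ultimately show ?thesis by simp
  qed
  also have "\<dots> * (\<Prod>i\<in>{..<r} - {p}. fact (a i + (r - Suc i)))
      = beta a r p * (\<Prod>i<r. fact (remove_cell a p i + (r - Suc i)))"
  proof -
    have "(\<Prod>i<r. fact (remove_cell a p i + (r - Suc i)) :: real) = fact (a p - 1 + (r - Suc p))
        * (\<Prod>i\<in>{..<r} - {p}. fact (a i + (r - Suc i)))"
      by (subst prod.remove[OF _ p(2)]) (auto simp: remove_cell_def)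
    then show ?thesis by (simp add: mult.assoc)
  qed
  finally have facts: "(\<Prod>i<r. fact (a i + (r - Suc i)) :: real)
      = beta a r p * (\<Prod>i<r. fact (remove_cell a p i + (r - Suc i)))" .
  have bp: "beta a r p > 0" using ap p by (simp add: beta_def)
  have "frobenius (remove_cell a p) r = (\<Prod>i<r. \<Prod>j\<in>{i<..<r}. beta a r i - beta a r j)
      * residue_factor (beta a r) {..<r} p / (\<Prod>i<r. fact (remove_cell a p i + (r - Suc i)))"
    unfolding frobenius_def prod_dividef b vandermonde_decrement[OF p(1) inj_on_beta[OF anti]] ..
  also have "\<dots> = frobenius a r * weight a r p"
    unfolding frobenius_def prod_dividef facts weight_def using bp by simp
  finally show ?thesis .
qed

lemma frobenius_empty: "frobenius (\<lambda>_. 0) r = 1"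
proof -
  have "(\<Prod>j\<in>{i<..<r}. beta (\<lambda>_. 0) r i - beta (\<lambda>_. 0) r j) = fact (r - Suc i)" if "i < r" for i
  proof -
    have "(\<Prod>j\<in>{i<..<r}. beta (\<lambda>_. 0) r i - beta (\<lambda>_. 0) r j) = (\<Prod>d\<in>{1..r - Suc i}. real d)"
      by (rule prod.reindex_bij_witness[of _ "\<lambda>d. d + i" "\<lambda>j. j - i"])
         (auto simp: beta_def of_nat_diff)
    then show ?thesis by (simp add: fact_prod)
  qed
  then show ?thesis by (simp add: frobenius_def)
qed

lemma shape_empty: "shape a r \<Longrightarrow> (\<Sum>i<r. a i) = 0 \<Longrightarrow> a = (\<lambda>_. 0)"
  by (auto simp: shape_def fun_eq_iff) (metis lessThan_iff not_le)

text \<open>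
  Removing the cell at a corner multiplies Frobenius' product by the weight of the corner, and the
  weights sum to \<open>n\<close>; so both sides satisfy the same recursion over the corners.\<close>

lemma card_ballot_words:
  assumes "shape a r"
  shows "real (card (ballot_words a)) = fact (\<Sum>i<r. a i) * frobenius a r"
  using assms
proof (induction "\<Sum>i<r. a i" arbitrary: a)
  case 0
  then have "a = (\<lambda>_. 0)" using shape_empty by simp
  moreover have "ballot_words (\<lambda>_. 0) = {[]}"
  proof -
    have "w = []" if "count_list w = (\<lambda>_. 0)" for w :: "nat list"
      using length_ballot_word(2)[OF _ that, of 0] by simp
    moreover have "count_list [] = (\<lambda>_. 0)" by (simp add: fun_eq_iff)
    ultimately show ?thesis by (auto simp: ballot_words_def ballot_def dominant_def)
  qed
  ultimately show ?case by (simp add: frobenius_empty)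
next
  case (Suc n)
  have "real (card (ballot_words a))
      = (\<Sum>i | i < r \<and> corner a i. real (card (ballot_words (remove_cell a i))))"
    using card_ballot_words_recursion[OF Suc.prems, of 0 "\<lambda>_. True"] Suc(2) by simp
  also have "\<dots> = (\<Sum>i | i < r \<and> corner a i. fact n * (frobenius a r * weight a r i))"
  proof (rule sum.cong)
    fix i assume "i \<in> {i. i < r \<and> corner a i}"
    then have i: "corner a i" by simp
    have n: "(\<Sum>j<r. remove_cell a i j) = n" using sum_remove_cell[OF Suc.prems i] Suc(2) by simp
    show "real (card (ballot_words (remove_cell a i))) = fact n * (frobenius a r * weight a r i)"
      using Suc(1)[OF n[symmetric] shape_remove_cell[OF Suc.prems i]] n
        frobenius_remove_cell[OF Suc.prems i] by simp
  qed simp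
  also have "\<dots> = (\<Sum>i<r. fact n * (frobenius a r * weight a r i))"
    by (rule sum.mono_neutral_left) (auto simp: weight_eq_0[OF Suc.prems])
  also have "\<dots> = fact n * frobenius a r * (\<Sum>i<r. weight a r i)"
    by (simp add: sum_distrib_left mult.assoc)
  also have "(\<Sum>i<r. weight a r i) = real (Suc n)"
    using sum_weight[of a r] Suc.prems Suc(2) by (simp add: shape_def)
  also have "fact n * frobenius a r * real (Suc n) = fact (Suc n) * frobenius a r" by simp
  finally show ?case using Suc(2) by simp
qed

lemma card_ballot_words_remove_cell:
  assumes "shape a r" "corner a i"
  shows "real (\<Sum>i<r. a i) * real (card (ballot_words (remove_cell a i)))
    = real (card (ballot_words a)) * weight a r i"
proof -
  let ?n = "\<Sum>j<r. remove_cell a i j"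
  have n: "(\<Sum>j<r. a j) = Suc ?n" using sum_remove_cell[OF assms] by simp
  show ?thesis
    unfolding card_ballot_words[OF shape_remove_cell[OF assms]] card_ballot_words[OF assms(1)]
      frobenius_remove_cell[OF assms] n by simp
qed

lemma hstar_single_row:
  fixes a :: "nat \<Rightarrow> nat"
  assumes "antimono a" "a 1 = 0" "0 < r"
  shows "hstar (\<lambda>i. real (a i)) r k 0 = ffact (real (a 0)) k"
proof (induction k)
  case (Suc k)
  have "hstar (\<lambda>i. real (a i)) r (Suc k) (Suc 0) = 0"
    by (rule hstar_eq_0[OF assms(1)]) (use assms(2) in simp)
  then show ?case using hstar_row[OF assms(3), of "\<lambda>i. real (a i)" k] Suc by (simp add: ffact_Suc)
qed simp

text \<open>
  Induction on the number of letters after the prefix: the count satisfies the recursion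
  \<open>ballot_words_recursion\<close>, and \<open>hstar_cotransition\<close> is that recursion
  for the right side. If the prefix is the whole word, the shape is a single row or both sides
  vanish.\<close>

lemma card_ballot_words_row_prefix:
  assumes "shape a r" "k \<le> (\<Sum>i<r. a i)"
  shows "real (card {w \<in> ballot_words a. take k w = replicate k 0}) * ffact (\<Sum>i<r. real (a i)) k
    = real (card (ballot_words a)) * hstar (\<lambda>i. real (a i)) r k 0"
  using assms
proof (induction "(\<Sum>i<r. a i) - k" arbitrary: a)
  case 0
  let ?n = "\<Sum>i<r. a i"
  have k: "k = ?n" using 0 by simp
  have anti: "antimono a" and supp: "\<forall>i\<ge>r. a i = 0" using 0 by (auto simp: shape_def)
  have full: "take k w = w" if "w \<in> ballot_words a" for w
    using that length_ballot_word(2)[OF supp] k by (simp add: ballot_words_def)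
  show ?case
  proof (cases "a 0 = ?n")
    case True
    have z: "a i = 0" if "i \<noteq> 0" for i
    proof (cases "i < r")
      case True
      have "a 0 + a i = sum a {0, i}" using that by simp
      also have "\<dots> \<le> ?n" using True by (intro sum_mono2) auto
      finally show ?thesis using \<open>a 0 = ?n\<close> by simp
    qed (use supp in simp)
    have cr: "count_list (replicate m 0) = (\<lambda>i. if i = 0 then m else 0)" for m :: nat
      by (auto simp: fun_eq_iff count_list_0_iff count_list_replicate)
    have single: "ballot_words a = {replicate k 0}"
    proof
      show "ballot_words a \<subseteq> {replicate k 0}"
      proof
        fix w assume w: "w \<in> ballot_words a"
        have "set w \<subseteq> {..<1}"
          by (rule length_ballot_word(1)[of 1 a]) (use w z in \<open>auto simp: ballot_words_def\<close>)
        moreover have "length w = k" using w length_ballot_word(2)[OF supp] k by (simp add: ballot_words_def)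
        ultimately have "w = replicate k 0" by (intro replicate_eqI) auto
        then show "w \<in> {replicate k 0}" by simp
      qed
      have "count_list (replicate k 0) = a" using z True k by (auto simp: cr fun_eq_iff)
      moreover have "ballot (replicate k 0)" by (simp add: ballot_def dominant_def cr)
      ultimately show "{replicate k 0} \<subseteq> ballot_words a" by (simp add: ballot_words_def)
    qed
    have same: "{w \<in> ballot_words a. take k w = replicate k 0} = ballot_words a"
      unfolding single by auto
    have "hstar (\<lambda>i. real (a i)) r k 0 = ffact (\<Sum>i<r. real (a i)) k"
    proof (cases "r = 0")
      case True
      then show ?thesis using k by simp
    next
      case False
      have "real (a 0) = (\<Sum>i<r. real (a i))" unfolding True by simp
      moreover have "hstar (\<lambda>i. real (a i)) r k 0 = ffact (real (a 0)) k"
        by (rule hstar_single_row[OF anti]) (use z False in auto)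
      ultimately show ?thesis by metis
    qed
    then show ?thesis unfolding same by (rule arg_cong[OF sym])
  next
    case False
    have "a 0 \<le> ?n"
      using supp member_le_sum[of 0 "{..<r}" a] by (cases "r = 0") auto
    then have lt: "a 0 < k" using False k by simp
    have "{w \<in> ballot_words a. take k w = replicate k 0} = {}"
    proof (rule ccontr)
      assume "\<not> ?thesis"
      then obtain w where w: "w \<in> ballot_words a" "take k w = replicate k 0" by auto
      then have "w = replicate k 0" using full by simp
      then have "a 0 = k" using w(1) by (auto simp: ballot_words_def count_list_replicate)
      then show False using lt by simp
    qed
    then show ?thesis using hstar_eq_0[OF anti lt] by (simp only: card.empty)
  qed
next
  case (Suc d)
  let ?n = "\<Sum>i<r. real (a i)"
  let ?h = "\<lambda>b. hstar (\<lambda>i. real (b i)) r k 0"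
  let ?H = "\<lambda>b. real (card {w \<in> ballot_words b. take k w = replicate k 0})"
  let ?C = "{i. i < r \<and> corner a i}"
  have kn: "k < (\<Sum>i<r. a i)" using Suc(2) by simp
  then have kn': "real k < ?n" by (metis of_nat_less_iff of_nat_sum)
  have IH: "?H (remove_cell a i) * ffact ?n (Suc k) = real (card (ballot_words a)) * (weight a r i * ?h (remove_cell a i))"
    if i: "corner a i" for i
  proof -
    have n: "Suc (\<Sum>j<r. remove_cell a i j) = (\<Sum>j<r. a j)" by (rule sum_remove_cell[OF Suc.prems(1) i])
    then have n': "(\<Sum>j<r. real (remove_cell a i j)) = ?n - 1" 
      using arg_cong[OF n, of real] by simp
    have "?H (remove_cell a i) * ffact (?n - 1) k = real (card (ballot_words (remove_cell a i))) * ?h (remove_cell a i)"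
      unfolding n'[symmetric] using n Suc(2) kn
      by (intro Suc(1) shape_remove_cell[OF Suc.prems(1) i]) auto
    then have "?H (remove_cell a i) * ffact ?n (Suc k) = (?n * real (card (ballot_words (remove_cell a i)))) * ?h (remove_cell a i)"
      unfolding ffact_Suc_left by simp
    also have "?n * real (card (ballot_words (remove_cell a i))) = real (card (ballot_words a)) * weight a r i"
      using card_ballot_words_remove_cell[OF Suc.prems(1) i] by simp
    finally show ?thesis by simp
  qed
  have "?H a * ffact ?n (Suc k) = (\<Sum>i\<in>?C. ?H (remove_cell a i) * ffact ?n (Suc k))"
    using card_ballot_words_recursion[OF Suc.prems(1) kn, of "\<lambda>u. u = replicate k 0"]
    by (simp add: sum_distrib_right)
  also have "\<dots> = real (card (ballot_words a)) * (\<Sum>i\<in>?C. weight a r i * ?h (remove_cell a i))"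
    unfolding sum_distrib_left by (intro sum.cong refl IH) simp
  also have "\<dots> = real (card (ballot_words a)) * ?h a * (?n - real k)"
    unfolding hstar_cotransition[OF Suc.prems(1)] by simp
  finally show ?case using kn' by (simp add: ffact_Suc)
qed

section \<open>Knuth moves on ballot words\<close>

text \<open>
  Position \<open>i\<close> is counted from 0 here, so an ascent at \<open>i\<close> is a descent
  of the tableau at \<open>i + 1\<close>.\<close>

definition asc :: "nat list \<Rightarrow> nat \<Rightarrow> bool" where
  "asc w i \<longleftrightarrow> Suc i < length w \<and> w ! i < w ! Suc i"

text \<open>
  The elementary Knuth transformations \<open>yzx \<leftrightarrow> yxz\<close> for \<open>x \<le>
  y < z\<close> and \<open>xzy \<leftrightarrow> zxy\<close> for \<open>x < y \<le> z\<close>. The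
  middle value decides which neighbours are exchanged. Outside these patterns the value has no
  meaning.\<close>

fun knuth_triple :: "nat \<Rightarrow> nat \<Rightarrow> nat \<Rightarrow> nat list" where
  "knuth_triple p q r = (if r \<le> p \<and> p < q \<or> q \<le> p \<and> p < r then [p, r, q] else [q, p, r])"

definition knuth :: "nat \<Rightarrow> nat list \<Rightarrow> nat list" where
  "knuth i w = take i w @ knuth_triple (w ! i) (w ! (i + 1)) (w ! (i + 2)) @ drop (i + 3) w"

lemma ballot_prefix: "ballot (u @ v) \<Longrightarrow> dominant u"
  unfolding ballot_def by (drule spec[of _ "length u"]) simp

text \<open>
  Exchanging two neighbours changes only one prefix content, the one that ends between them.\<close>

lemma ballot_swap:
  assumes "ballot (u @ x # y # v)" "dominant (u @ [y])"
  shows "ballot (u @ y # x # v)"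
  unfolding ballot_def
proof
  fix m
  have b: "dominant (take m (u @ x # y # v))" using assms(1) by (simp add: ballot_def)
  consider "m \<le> length u" | "m = Suc (length u)" | k where "m = length u + Suc (Suc k)"
    by (metis add_Suc_right le_add_diff_inverse less_Suc_eq_le not0_implies_Suc not_less
        add.right_neutral)
  then show "dominant (take m (u @ y # x # v))"
  proof cases
    case 3
    then have "count_list (take m (u @ y # x # v)) = count_list (take m (u @ x # y # v))"
      by (auto simp: fun_eq_iff)
    then show ?thesis using b by (simp add: dominant_def)
  qed (use b assms(2) in simp_all)
qed

lemma ballot_smaller_first:
  assumes "ballot (u @ z # x # v)" "x < z"
  shows "ballot (u @ x # z # v)"
proof (rule ballot_swap[OF assms(1)])
  have "dominant u" "dominant (u @ [z, x])"
    using ballot_prefix[of u] ballot_prefix[of "u @ [z, x]" v] assms(1) by auto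
  show "dominant (u @ [x])"
    unfolding dominant_def
  proof
    fix j
    have "count_list u (Suc j) \<le> count_list u j"
      and "count_list (u @ [z, x]) (Suc j) \<le> count_list (u @ [z, x]) j"
      using \<open>dominant u\<close> \<open>dominant (u @ [z, x])\<close> by (auto simp: dominant_def)
    then show "count_list (u @ [x]) (Suc j) \<le> count_list (u @ [x]) j"
      using assms(2) by (auto split: if_splits)
  qed
qed

text \<open>
  The extra condition is needed only for consecutive letters, where the larger one may have to
  wait for the smaller one.\<close>

lemma ballot_larger_first:
  assumes "ballot (u @ x # z # v)" "x < z" "z = Suc x \<Longrightarrow> count_list u z < count_list u x"
  shows "ballot (u @ z # x # v)"
proof (rule ballot_swap[OF assms(1)])
  have "dominant u" "dominant (u @ [x, z])"
    using ballot_prefix[of u] ballot_prefix[of "u @ [x, z]" v] assms(1) by auto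
  show "dominant (u @ [z])"
    unfolding dominant_def
  proof
    fix j
    have "count_list u (Suc j) \<le> count_list u j"
      and "count_list (u @ [x, z]) (Suc j) \<le> count_list (u @ [x, z]) j"
      using \<open>dominant u\<close> \<open>dominant (u @ [x, z])\<close> by (auto simp: dominant_def)
    then show "count_list (u @ [z]) (Suc j) \<le> count_list (u @ [z]) j"
      using assms(2,3) by (auto split: if_splits)
  qed
qed

text \<open>
  An exchange that puts the larger letter first could only break the ballot condition for
  neighbouring values \<open>x, x + 1\<close>; then the third letter equals one of them and
  supplies the missing margin.\<close>

lemma ballot_knuth_triple:
  assumes "ballot (u @ p # q # r # v)" "(p < q) \<noteq> (q < r)"
  shows "ballot (u @ knuth_triple p q r @ v)"
proof -
  consider "r \<le> p" "p < q" | "q \<le> p" "p < r" | "p < r" "r \<le> q" | "q < r" "r \<le> p"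
    using assms(2) by linarith
  then show ?thesis
  proof cases
    case 1
    then show ?thesis using ballot_smaller_first[of "u @ [p]" q r v] assms(1) by simp
  next
    case 2
    have "dominant u" using ballot_prefix assms(1) by blast
    then have "r = Suc q \<Longrightarrow> count_list (u @ [p]) r < count_list (u @ [p]) q"
      using 2 by (auto simp: dominant_def less_Suc_eq_le)
    then show ?thesis using 2 ballot_larger_first[of "u @ [p]" q r v] assms(1) by simp
  next
    case 3
    have "dominant (u @ [p, q, r])" using ballot_prefix[of "u @ [p, q, r]" v] assms(1) by simp
    then have "count_list (u @ [p, q, r]) (Suc p) \<le> count_list (u @ [p, q, r]) p"
      unfolding dominant_def by (rule spec)
    moreover have "q = Suc p \<Longrightarrow> r = q" using 3 by simp
    ultimately have "q = Suc p \<Longrightarrow> count_list u q < count_list u p" by auto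
    then show ?thesis using 3 ballot_larger_first[of u p q "r # v"] assms(1) by simp
  next
    case 4
    then show ?thesis using ballot_smaller_first[of u p q "r # v"] assms(1) by auto
  qed
qed

lemma split_at_three:
  assumes "i + 2 < length w"
  obtains u p q r v where "w = u @ p # q # r # v" "length u = i"
proof -
  have "drop i w = w ! i # w ! Suc i # w ! Suc (Suc i) # drop (Suc (Suc (Suc i))) w"
    using assms by (simp add: Cons_nth_drop_Suc)
  then have "w = take i w @ w ! i # w ! Suc i # w ! Suc (Suc i) # drop (Suc (Suc (Suc i))) w"
    by (metis append_take_drop_id)
  moreover have "length (take i w) = i" using assms by simp
  ultimately show ?thesis by (rule that)
qed

lemma knuth_append:
  "knuth (length u) (u @ p # q # r # v) = u @ knuth_triple p q r @ v"
  by (simp add: knuth_def nth_append)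

lemma asc_append:
  "asc (u @ p # q # v) (length u) \<longleftrightarrow> p < q"
  "asc (u @ p # q # r # v) (Suc (length u)) \<longleftrightarrow> q < r"
  "asc (u @ p # q # r # s # v) (Suc (Suc (length u))) \<longleftrightarrow> r < s"
  by (simp_all add: asc_def nth_append)

lemma length_knuth: "i + 2 < length w \<Longrightarrow> length (knuth i w) = length w"
  by (erule split_at_three) (auto simp: knuth_append)

lemma asc_knuth_far:
  assumes "i + 2 < length w" "Suc j < i \<or> i + 2 < j"
  shows "asc (knuth i w) j \<longleftrightarrow> asc w j"
proof -
  obtain u p q r v where w: "w = u @ p # q # r # v" "length u = i" using split_at_three[OF assms(1)] .
  have kw: "knuth i w = u @ knuth_triple p q r @ v" using knuth_append[of u p q r v] w by simp
  have nth: "knuth i w ! k = w ! k" if "k < i \<or> i + 2 < k" for k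
  proof (cases "k < i")
    case True
    then show ?thesis unfolding kw unfolding w(1) using w(2) by (simp add: nth_append)
  next
    case False
    then have "k = length u + (3 + (k - i - 3))" using that w(2) by simp
    then obtain m where m: "k = length u + (3 + m)" ..
    show ?thesis unfolding kw unfolding w(1) m nth_append_length_plus by (simp add: eval_nat_numeral)
  qed
  then show ?thesis using assms nth[of j] nth[of "Suc j"] length_knuth[OF assms(1)]
    by (auto simp: asc_def)
qed

lemma knuth_involution:
  assumes "w \<in> ballot_words a" "i + 2 < length w" "asc w i \<noteq> asc w (Suc i)"
  shows "knuth i w \<in> ballot_words a" "knuth i (knuth i w) = w"
    and "asc (knuth i w) i \<longleftrightarrow> \<not> asc w i" "asc (knuth i w) (Suc i) \<longleftrightarrow> \<not> asc w (Suc i)"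
proof -
  obtain u p q r v where w: "w = u @ p # q # r # v" "length u = i" using split_at_three[OF assms(2)] .
  have ne: "(p < q) \<noteq> (q < r)" using assms(3) w asc_append by blast
  have k: "knuth i w = u @ knuth_triple p q r @ v" using w knuth_append by blast
  have "count_list (knuth i w) = count_list w" unfolding k by (auto simp: w(1) fun_eq_iff)
  then show "knuth i w \<in> ballot_words a"
    using assms(1) ballot_knuth_triple[OF _ ne] k w by (auto simp: ballot_words_def)
  show "knuth i (knuth i w) = w"
    unfolding k using ne w by (auto simp: knuth_append simp del: append_assoc)
  show "asc (knuth i w) i \<longleftrightarrow> \<not> asc w i" "asc (knuth i w) (Suc i) \<longleftrightarrow> \<not> asc w (Suc i)"
    unfolding k using ne w by (auto simp: asc_append)
qed

lemma card_eq_by_inverses: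
  assumes "finite A" "finite B"
    and "\<And>x. x \<in> A \<Longrightarrow> f x \<in> B \<and> g (f x) = x" "\<And>y. y \<in> B \<Longrightarrow> g y \<in> A \<and> f (g y) = y"
  shows "card A = card B"
  by (rule bij_betw_same_card[of f], rule bij_betw_byWitness[where f' = g]) (use assms in auto)

text \<open>
  The Knuth move at \<open>i\<close> matches the words with an ascent at \<open>i\<close> only and
  those with an ascent at \<open>i + 1\<close> only; words with both ascents count on both sides.\<close>

lemma card_asc_shift:
  assumes "finite (ballot_words a)" "\<And>w. w \<in> ballot_words a \<Longrightarrow> i + 2 < length w"
    and "\<And>w. w \<in> ballot_words a \<Longrightarrow> Q (knuth i w) \<longleftrightarrow> Q w"
  shows "card {w \<in> ballot_words a. asc w i \<and> Q w} = card {w \<in> ballot_words a. asc w (Suc i) \<and> Q w}"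
proof -
  let ?B = "\<lambda>P. {w \<in> ballot_words a. P w}"
  have fin: "finite (?B P)" for P using assms(1) by simp
  have ex: "card (?B (\<lambda>w. asc w i \<and> \<not> asc w (Suc i) \<and> Q w)) = card (?B (\<lambda>w. \<not> asc w i \<and> asc w (Suc i) \<and> Q w))"
    by (rule card_eq_by_inverses[where f = "knuth i" and g = "knuth i"])
       (use assms knuth_involution in auto)
  have "card (?B (\<lambda>w. asc w i \<and> Q w)) = card (?B (\<lambda>w. asc w i \<and> asc w (Suc i) \<and> Q w))
      + card (?B (\<lambda>w. asc w i \<and> \<not> asc w (Suc i) \<and> Q w))"
    by (subst card_Un_disjoint[symmetric]) (auto simp: fin intro!: arg_cong[where f = card])
  also have "\<dots> = card (?B (\<lambda>w. asc w i \<and> asc w (Suc i) \<and> Q w))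
      + card (?B (\<lambda>w. \<not> asc w i \<and> asc w (Suc i) \<and> Q w))" by (simp only: ex)
  also have "\<dots> = card (?B (\<lambda>w. asc w (Suc i) \<and> Q w))"
    by (subst card_Un_disjoint[symmetric]) (auto simp: fin intro!: arg_cong[where f = card])
  finally show ?thesis .
qed

text \<open>
  A Knuth move can also change the ascents next to its three letters. In the four situations that
  arise when a double ascent moves by one position it does not, as a case distinction on four
  consecutive letters shows.\<close>

lemma asc_knuth_adjacent:
  assumes "i + 3 < length w" "asc w (Suc i)"
  shows "asc w i \<Longrightarrow> \<not> asc w (i + 2) \<Longrightarrow> asc (knuth (Suc i) w) i"
    and "\<not> asc w i \<Longrightarrow> asc w (i + 2) \<Longrightarrow> asc (knuth i w) (i + 2)"
    and "asc w i \<Longrightarrow> \<not> asc w (i + 2) \<Longrightarrow> asc (knuth i (knuth (Suc i) w)) (i + 2)"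
    and "\<not> asc w i \<Longrightarrow> asc w (i + 2) \<Longrightarrow> asc (knuth (Suc i) (knuth i w)) i"
proof -
  have "i + 2 < length w" using assms(1) by simp
  from split_at_three[OF this] obtain u p q r v where w: "w = u @ p # q # r # v" "length u = i" .
  have "v \<noteq> []" using assms(1) w by auto
  then obtain s v' where w': "w = u @ p # q # r # s # v'" using w by (cases v) auto
  have a: "asc w i \<longleftrightarrow> p < q" "asc w (i + 2) \<longleftrightarrow> r < s" "q < r"
    using asc_append[of u] w' w(2) assms(2) by auto
  have k1: "knuth (Suc i) w = u @ p # knuth_triple q r s @ v'"
    using knuth_append[of "u @ [p]" q r s v'] w' w(2) by simp
  have k0: "knuth i w = u @ knuth_triple p q r @ s # v'"
    using knuth_append[of u p q r "s # v'"] w' w(2) by simp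
  have kk: "knuth i (u @ p' # q' # r' # z) = u @ knuth_triple p' q' r' @ z"
    and kk': "knuth (Suc i) (u @ p' # q' # r' # s' # z') = u @ p' # knuth_triple q' r' s' @ z'"
    for p' q' r' s' z z'
    using knuth_append[of u] knuth_append[of "u @ [p']"] w(2) by auto
  have aa: "asc (u @ p' # q' # z) i \<longleftrightarrow> p' < q'" "asc (u @ p' # q' # r' # s' # z) (Suc (Suc i)) \<longleftrightarrow> r' < s'"
    for p' q' r' s' z using asc_append[of u] w(2) by auto
  show "asc w i \<Longrightarrow> \<not> asc w (i + 2) \<Longrightarrow> asc (knuth (Suc i) w) i"
    using a unfolding k1 by (auto simp: aa)
  show "\<not> asc w i \<Longrightarrow> asc w (i + 2) \<Longrightarrow> asc (knuth i w) (i + 2)"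
    using a unfolding k0 by (auto simp: aa)
  show "asc w i \<Longrightarrow> \<not> asc w (i + 2) \<Longrightarrow> asc (knuth i (knuth (Suc i) w)) (i + 2)"
    using a unfolding k1 by (auto simp: aa kk)
  show "\<not> asc w i \<Longrightarrow> asc w (i + 2) \<Longrightarrow> asc (knuth (Suc i) (knuth i w)) i"
    using a unfolding k0 by (auto simp: aa kk')
qed

text \<open>
  With A for an ascent and N for none, two Knuth moves lead from AAN through ANA to NAA and back.\<close>

lemma card_double_asc_shift:
  assumes "finite (ballot_words a)" "\<And>w. w \<in> ballot_words a \<Longrightarrow> i + 3 < length w"
  shows "card {w \<in> ballot_words a. asc w i \<and> asc w (i + 1)}
       = card {w \<in> ballot_words a. asc w (i + 1) \<and> asc w (i + 2)}"
proof -
  let ?B = "\<lambda>P. {w \<in> ballot_words a. P w}"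
  have fin: "finite (?B P)" for P using assms(1) by simp
  have ex: "card (?B (\<lambda>w. asc w i \<and> asc w (i + 1) \<and> \<not> asc w (i + 2)))
      = card (?B (\<lambda>w. \<not> asc w i \<and> asc w (i + 1) \<and> asc w (i + 2)))"
  proof (rule card_eq_by_inverses[where f = "\<lambda>w. knuth i (knuth (Suc i) w)" and g = "\<lambda>w. knuth (Suc i) (knuth i w)"])
    fix w assume "w \<in> ?B (\<lambda>w. asc w i \<and> asc w (i + 1) \<and> \<not> asc w (i + 2))"
    then have w: "w \<in> ballot_words a" "asc w i" "asc w (Suc i)" "\<not> asc w (i + 2)" by auto
    have l: "i + 3 < length w" using assms(2) w(1) .
    let ?w1 = "knuth (Suc i) w"
    have l1: "i + 3 < length ?w1" using l length_knuth[of "Suc i" w] by simp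
    have k1: "?w1 \<in> ballot_words a" "knuth (Suc i) ?w1 = w" "\<not> asc ?w1 (Suc i)" "asc ?w1 i"
      using knuth_involution[of w a "Suc i"] w l asc_knuth_adjacent(1)[OF l w(3,2,4)] by auto
    let ?w2 = "knuth i ?w1"
    have "?w2 \<in> ballot_words a" "knuth i ?w2 = ?w1" "\<not> asc ?w2 i" "asc ?w2 (Suc i)"
      using knuth_involution[of ?w1 a i] k1 l1 by auto
    then show "?w2 \<in> ?B (\<lambda>w. \<not> asc w i \<and> asc w (i + 1) \<and> asc w (i + 2))
        \<and> knuth (Suc i) (knuth i ?w2) = w"
      using k1(2) asc_knuth_adjacent(3)[OF l w(3,2,4)] by simp
  next
    fix w assume "w \<in> ?B (\<lambda>w. \<not> asc w i \<and> asc w (i + 1) \<and> asc w (i + 2))"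
    then have w: "w \<in> ballot_words a" "\<not> asc w i" "asc w (Suc i)" "asc w (i + 2)" by auto
    have l: "i + 3 < length w" using assms(2) w(1) .
    let ?w1 = "knuth i w"
    have l1: "i + 3 < length ?w1" using l length_knuth[of i w] by simp
    have k1: "?w1 \<in> ballot_words a" "knuth i ?w1 = w" "\<not> asc ?w1 (Suc i)" "asc ?w1 (i + 2)"
      using knuth_involution[of w a i] w l asc_knuth_adjacent(2)[OF l w(3,2,4)] by auto
    let ?w2 = "knuth (Suc i) ?w1"
    have "?w2 \<in> ballot_words a" "knuth (Suc i) ?w2 = ?w1" "asc ?w2 (Suc i)" "\<not> asc ?w2 (i + 2)"
      using knuth_involution[of ?w1 a "Suc i"] k1 l1 by auto
    then show "?w2 \<in> ?B (\<lambda>w. asc w i \<and> asc w (i + 1) \<and> \<not> asc w (i + 2))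
        \<and> knuth i (knuth (Suc i) ?w2) = w"
      using k1(2) asc_knuth_adjacent(4)[OF l w(3,2,4)] by simp
  qed (rule fin)+
  have "card (?B (\<lambda>w. asc w i \<and> asc w (i + 1)))
      = card (?B (\<lambda>w. asc w i \<and> asc w (i + 1) \<and> asc w (i + 2)))
      + card (?B (\<lambda>w. asc w i \<and> asc w (i + 1) \<and> \<not> asc w (i + 2)))"
    by (subst card_Un_disjoint[symmetric]) (auto simp: fin intro!: arg_cong[where f = card])
  also have "\<dots> = card (?B (\<lambda>w. asc w i \<and> asc w (i + 1) \<and> asc w (i + 2)))
      + card (?B (\<lambda>w. \<not> asc w i \<and> asc w (i + 1) \<and> asc w (i + 2)))" by (simp only: ex)
  also have "\<dots> = card (?B (\<lambda>w. asc w (i + 1) \<and> asc w (i + 2)))"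
    by (subst card_Un_disjoint[symmetric]) (auto simp: fin intro!: arg_cong[where f = card])
  finally show ?thesis .
qed

lemma card_asc:
  assumes "finite (ballot_words a)" "\<And>w. w \<in> ballot_words a \<Longrightarrow> length w = n" "Suc i < n"
  shows "card {w \<in> ballot_words a. asc w i} = card {w \<in> ballot_words a. asc w 0}"
  using assms(3)
proof (induction i)
  case (Suc i)
  then show ?case using card_asc_shift[OF assms(1), of i "\<lambda>_. True"] assms(2) by simp
qed simp

lemma card_double_asc:
  assumes "finite (ballot_words a)" "\<And>w. w \<in> ballot_words a \<Longrightarrow> length w = n" "i + 2 < n"
  shows "card {w \<in> ballot_words a. asc w i \<and> asc w (Suc i)} = card {w \<in> ballot_words a. asc w 0 \<and> asc w 1}"
  using assms(3)
proof (induction i)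
  case (Suc i)
  then show ?case using card_double_asc_shift[OF assms(1), of i] assms(2) by simp
qed simp

text \<open>
  Moving the right ascent is possible as long as it stays clear of the left one, and vice versa.
  So all pairs at distance at least two are linked: first the left ascent is moved to the front,
  then the right one is moved to position 2.\<close>

lemma card_separated_asc:
  assumes "finite (ballot_words a)" "\<And>w. w \<in> ballot_words a \<Longrightarrow> length w = n" "j + 2 \<le> i" "Suc i < n"
  shows "card {w \<in> ballot_words a. asc w j \<and> asc w i} = card {w \<in> ballot_words a. asc w 0 \<and> asc w 2}"
proof -
  have right: "card {w \<in> ballot_words a. asc w j \<and> asc w (j + 2)} = card {w \<in> ballot_words a. asc w j \<and> asc w i}"
    if "j + 2 \<le> i" "Suc i < n" for i j
    using that
  proof (induction i rule: dec_induct)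
    case (step i)
    have "card {w \<in> ballot_words a. asc w i \<and> asc w j} = card {w \<in> ballot_words a. asc w (Suc i) \<and> asc w j}"
      by (rule card_asc_shift[OF assms(1)]) (use step assms(2) in \<open>auto simp: asc_knuth_far\<close>)
    then show ?case using step by (simp add: conj_commute)
  qed simp
  have left: "card {w \<in> ballot_words a. asc w j \<and> asc w i} = card {w \<in> ballot_words a. asc w 0 \<and> asc w i}"
    if "j + 2 \<le> i" "Suc i < n" for i j
    using that
  proof (induction j)
    case (Suc j)
    have "card {w \<in> ballot_words a. asc w j \<and> asc w i} = card {w \<in> ballot_words a. asc w (Suc j) \<and> asc w i}"
      by (rule card_asc_shift[OF assms(1)]) (use Suc assms(2) in \<open>auto simp: asc_knuth_far\<close>)
    then show ?case using Suc by simp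
  qed simp
  show ?thesis using left[OF assms(3,4)] right[of 0 i] assms(3,4) by (simp add: numeral_2_eq_2)
qed

lemma take_replicate_iff_no_asc:
  assumes "ballot w" "k < length w"
  shows "take (Suc k) w = replicate (Suc k) 0 \<longleftrightarrow> (\<forall>i<k. \<not> asc w i)"
proof -
  obtain y ys where w: "w = y # ys" using assms(2) by (cases w) auto
  have "dominant (take 1 w)" using assms(1) unfolding ballot_def by (rule spec)
  then have "count_list [y] (Suc j) \<le> count_list [y] j" for j by (simp add: w dominant_def)
  from this[of "y - 1"] have first: "w ! 0 = 0" by (simp add: w split: if_splits)
  have "take (Suc k) w = replicate (Suc k) 0 \<longleftrightarrow> (\<forall>i\<le>k. w ! i = 0)"
    using assms(2) by (auto simp: list_eq_iff_nth_eq less_Suc_eq_le simp del: replicate_Suc)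
  also have "\<dots> \<longleftrightarrow> (\<forall>i<k. \<not> asc w i)"
  proof
    assume no: "\<forall>i<k. \<not> asc w i"
    have "w ! i = 0" if "i \<le> k" for i
      using that
    proof (induction i)
      case (Suc i)
      then show ?case using no[rule_format, of i] assms(2) by (simp add: asc_def)
    qed (use first in simp)
    then show "\<forall>i\<le>k. w ! i = 0" by simp
  qed (auto simp: asc_def)
  finally show ?thesis .
qed

section \<open>Partitions and their conjugates\<close>

definition row_length :: "nat list \<Rightarrow> nat \<Rightarrow> nat" where
  "row_length \<mu> j = part \<mu> (Suc j)"

lemma row_length_eq: "row_length \<mu> j = (if j < length \<mu> then \<mu> ! j else 0)"
  by (simp add: row_length_def part_def)

lemma sum_row_length: "(\<Sum>j<length \<mu>. row_length \<mu> j) = sum_list \<mu>"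
  by (simp add: row_length_eq sum_list_sum_nth atLeast0LessThan)

lemma shape_row_length:
  assumes "is_partition \<mu> n"
  shows "shape (row_length \<mu>) (length \<mu>)"
proof -
  have "row_length \<mu> (Suc j) \<le> row_length \<mu> j" for j
    using assms sorted_wrt_nth_less[of "(\<ge>)" \<mu> j "Suc j"]
    by (auto simp: row_length_eq is_partition_def)
  then show ?thesis by (simp add: shape_def antimono_iff_le_Suc row_length_eq)
qed

lemma part_antimono: "is_partition \<mu> n \<Longrightarrow> 1 \<le> j \<Longrightarrow> j \<le> j' \<Longrightarrow> part \<mu> j' \<le> part \<mu> j"
  using shape_row_length[of \<mu> n] antimonoD[of "row_length \<mu>" "j - 1" "j' - 1"]
  by (auto simp: shape_def row_length_def)

lemma mem_diagram: "(i, j) \<in> diagram \<mu> \<longleftrightarrow> 1 \<le> i \<and> 1 \<le> j \<and> i \<le> part \<mu> j"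
  by (auto simp: diagram_def part_def)

lemma bij_betw_diagram:
  "bij_betw (\<lambda>(j, i). (Suc i, Suc j)) (Sigma {..<length \<mu>} (\<lambda>j. {..<row_length \<mu> j})) (diagram \<mu>)"
  by (rule bij_betw_byWitness[where f' = "\<lambda>(i, j). (j - 1, i - 1)"])
     (auto simp: diagram_def row_length_def)

lemma finite_diagram: "finite (diagram \<mu>)"
  using bij_betw_finite[OF bij_betw_diagram[of \<mu>]] by simp

lemma card_diagram: "card (diagram \<mu>) = sum_list \<mu>"
  using bij_betw_same_card[OF bij_betw_diagram[of \<mu>]] by (simp add: sum_row_length)

lemma finite_column: "finite {j. (i, j) \<in> diagram \<mu>}"
  by (rule finite_subset[of _ "snd ` diagram \<mu>"]) (force simp: finite_diagram)+

lemma length_conjugate: "length (conjugate \<mu>) = part \<mu> 1"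
  by (simp add: conjugate_def del: upt_Suc)

lemma nth_conjugate: "k < part \<mu> 1 \<Longrightarrow> conjugate \<mu> ! k = card {j. (Suc k, j) \<in> diagram \<mu>}"
  by (simp add: conjugate_def del: upt_Suc)

lemma part_conjugate: "part (conjugate \<mu>) i = card {j. (i, j) \<in> diagram \<mu>}" if "is_partition \<mu> n"
proof -
  consider "i = 0" | k where "i = Suc k" "k < part \<mu> 1" | "part \<mu> 1 < i"
    by (metis Suc_le_eq not0_implies_Suc not_le)
  then show ?thesis
  proof cases
    case 1
    then show ?thesis by (simp add: part_def mem_diagram)
  next
    case 2
    then show ?thesis
      using nth_conjugate[of k \<mu>] length_conjugate[of \<mu>] by (simp add: part_def[of "conjugate \<mu>"])
  next
    case 3
    then have "(i, j) \<notin> diagram \<mu>" for j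
      using part_antimono[OF that, of 1 j] by (auto simp: mem_diagram)
    then show ?thesis using 3 length_conjugate[of \<mu>] by (simp add: part_def[of "conjugate \<mu>"])
  qed
qed

text \<open>
  Columns have no gaps because the rows are weakly decreasing; so the conjugate describes the
  columns as intervals.\<close>

lemma column_eq:
  assumes "is_partition \<mu> n" "1 \<le> i"
  shows "{j. (i, j) \<in> diagram \<mu>} = {1..part (conjugate \<mu>) i}"
proof -
  let ?A = "{j. (i, j) \<in> diagram \<mu>}"
  have down: "j' \<in> ?A" if "j \<in> ?A" "1 \<le> j'" "j' \<le> j" for j j'
    using that part_antimono[OF assms(1) that(2,3)] by (auto simp: mem_diagram)
  have "?A = {1..card ?A}"
  proof (cases "?A = {}")
    case False
    have mx: "Max ?A \<in> ?A" by (rule Max_in[OF finite_column False])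
    have "?A = {1..Max ?A}"
    proof
      show "?A \<subseteq> {1..Max ?A}" using Max_ge[OF finite_column, of _ i \<mu>] by (auto simp: mem_diagram)
      show "{1..Max ?A} \<subseteq> ?A" using down[OF mx] by auto
    qed
    then show ?thesis by (metis card_atLeastAtMost diff_Suc_1)
  qed simp
  then show ?thesis using part_conjugate[OF assms(1)] by simp
qed

lemma mem_diagram_conjugate:
  assumes "is_partition \<mu> n"
  shows "(i, j) \<in> diagram (conjugate \<mu>) \<longleftrightarrow> (j, i) \<in> diagram \<mu>"
proof (cases "1 \<le> j")
  case True
  have "i \<in> {i. (j, i) \<in> diagram \<mu>} \<longleftrightarrow> i \<in> {1..part (conjugate \<mu>) j}"
    using column_eq[OF assms True] by simp
  then show ?thesis using True by (auto simp: mem_diagram)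
qed (auto simp: mem_diagram)

lemma diagram_conjugate:
  assumes "is_partition \<mu> n"
  shows "diagram (conjugate \<mu>) = prod.swap ` diagram \<mu>"
  using mem_diagram_conjugate[OF assms] by force

lemma sum_list_conjugate:
  assumes "is_partition \<mu> n"
  shows "sum_list (conjugate \<mu>) = sum_list \<mu>"
  unfolding card_diagram[symmetric] diagram_conjugate[OF assms]
  by (rule card_image, rule inj_on_subset[OF inj_swap subset_UNIV])

lemma is_partition_conjugate:
  assumes "is_partition \<mu> n"
  shows "is_partition (conjugate \<mu>) n"
proof -
  have nth: "conjugate \<mu> ! k = card {j. (Suc k, j) \<in> diagram \<mu>}" if "k < length (conjugate \<mu>)" for k
    using that nth_conjugate length_conjugate by simp
  have "sorted_wrt (\<ge>) (conjugate \<mu>)"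
    unfolding sorted_wrt_iff_nth_less
  proof (intro allI impI)
    fix k l assume kl: "k < l" "l < length (conjugate \<mu>)"
    have "{j. (Suc l, j) \<in> diagram \<mu>} \<subseteq> {j. (Suc k, j) \<in> diagram \<mu>}"
      using kl by (auto simp: mem_diagram)
    then show "conjugate \<mu> ! l \<le> conjugate \<mu> ! k"
      using kl nth card_mono[OF finite_column] by simp
  qed
  moreover have "0 < x" if x: "x \<in> set (conjugate \<mu>)" for x
  proof -
    obtain k where k: "k < length (conjugate \<mu>)" "x = conjugate \<mu> ! k"
      using x by (metis in_set_conv_nth)
    have "k < part \<mu> 1" using k(1) by (simp add: length_conjugate)
    then have "1 \<in> {j. (Suc k, j) \<in> diagram \<mu>}" by (simp add: mem_diagram)
    then show ?thesis using nth[OF k(1)] k(2) finite_column[of "Suc k" \<mu>] card_gt_0_iff by fastforce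
  qed
  ultimately show ?thesis using sum_list_conjugate[OF assms] assms by (simp add: is_partition_def)
qed

section \<open>Standard tableaux as ballot words\<close>

definition cell_of :: "nat list \<Rightarrow> (nat \<times> nat \<Rightarrow> nat) \<Rightarrow> nat \<Rightarrow> nat \<times> nat" where
  "cell_of \<mu> T = inv_into (diagram \<mu>) T"

definition word_of :: "nat list \<Rightarrow> (nat \<times> nat \<Rightarrow> nat) \<Rightarrow> nat list" where
  "word_of \<mu> T = map (\<lambda>m. snd (cell_of \<mu> T (Suc m)) - 1) [0..<sum_list \<mu>]"

lemma SYT_bij: "T \<in> SYT \<mu> \<Longrightarrow> bij_betw T (diagram \<mu>) {1..sum_list \<mu>}"
  by (simp add: SYT_def)

lemma SYT_row: "T \<in> SYT \<mu> \<Longrightarrow> (i, j) \<in> diagram \<mu> \<Longrightarrow> (i', j) \<in> diagram \<mu> \<Longrightarrow> i < i' \<Longrightarrow> T (i, j) < T (i', j)"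
  and SYT_column: "T \<in> SYT \<mu> \<Longrightarrow> (i, j) \<in> diagram \<mu> \<Longrightarrow> (i, j') \<in> diagram \<mu> \<Longrightarrow> j < j' \<Longrightarrow> T (i, j) < T (i, j')"
  by (auto simp: SYT_def)

lemma cell_of_entry:
  assumes "T \<in> SYT \<mu>"
  shows "c \<in> diagram \<mu> \<Longrightarrow> cell_of \<mu> T (T c) = c"
    and "1 \<le> m \<Longrightarrow> m \<le> sum_list \<mu> \<Longrightarrow> cell_of \<mu> T m \<in> diagram \<mu>"
    and "1 \<le> m \<Longrightarrow> m \<le> sum_list \<mu> \<Longrightarrow> T (cell_of \<mu> T m) = m"
    and "c \<in> diagram \<mu> \<Longrightarrow> 1 \<le> T c \<and> T c \<le> sum_list \<mu>"
proof -
  have inj: "inj_on T (diagram \<mu>)" and im: "T ` diagram \<mu> = {1..sum_list \<mu>}"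
    using SYT_bij[OF assms] by (auto simp: bij_betw_def)
  show "c \<in> diagram \<mu> \<Longrightarrow> cell_of \<mu> T (T c) = c" by (simp add: cell_of_def inj)
  show "c \<in> diagram \<mu> \<Longrightarrow> 1 \<le> T c \<and> T c \<le> sum_list \<mu>" using im by auto
  assume "1 \<le> m" "m \<le> sum_list \<mu>"
  then have "m \<in> T ` diagram \<mu>" using im by simp
  then show "cell_of \<mu> T m \<in> diagram \<mu>" "T (cell_of \<mu> T m) = m"
    unfolding cell_of_def by (rule inv_into_into, rule f_inv_into_f)
qed

lemma length_word_of [simp]: "length (word_of \<mu> T) = sum_list \<mu>"
  by (simp add: word_of_def)

lemma nth_word_of_entry:
  assumes "T \<in> SYT \<mu>" "(i, j) \<in> diagram \<mu>"
  shows "word_of \<mu> T ! (T (i, j) - 1) = j - 1"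
proof -
  have "T (i, j) - 1 < sum_list \<mu>" "Suc (T (i, j) - 1) = T (i, j)"
    using cell_of_entry(4)[OF assms] by auto
  then show ?thesis using cell_of_entry(1)[OF assms] by (simp add: word_of_def)
qed

lemma count_list_card: "count_list xs x = card {k. k < length xs \<and> xs ! k = x}"
  by (simp add: count_list_eq_length_filter length_filter_conv_card eq_commute)

text \<open>
  The prefix of length \<open>m\<close> has as content the row lengths of the subtableau of the
  entries up to \<open>m\<close>.\<close>

lemma count_word_of:
  assumes "T \<in> SYT \<mu>" "m \<le> sum_list \<mu>"
  shows "count_list (take m (word_of \<mu> T)) j = card {i. (i, Suc j) \<in> diagram \<mu> \<and> T (i, Suc j) \<le> m}"
proof -
  let ?A = "{k. k < m \<and> word_of \<mu> T ! k = j}"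
  let ?B = "{i. (i, Suc j) \<in> diagram \<mu> \<and> T (i, Suc j) \<le> m}"
  have "count_list (take m (word_of \<mu> T)) j = card ?A"
    unfolding count_list_card using assms(2) by (intro arg_cong[where f = card]) auto
  also have "card ?A = card ?B"
  proof (rule bij_betw_same_card[of "\<lambda>k. fst (cell_of \<mu> T (Suc k))"],
         rule bij_betw_byWitness[where f' = "\<lambda>i. T (i, Suc j) - 1"])
    have cell: "cell_of \<mu> T (Suc k) = (fst (cell_of \<mu> T (Suc k)), Suc j)
        \<and> cell_of \<mu> T (Suc k) \<in> diagram \<mu> \<and> T (cell_of \<mu> T (Suc k)) = Suc k" if "k \<in> ?A" for k
    proof -
      have k: "k < sum_list \<mu>" "word_of \<mu> T ! k = j" using that assms(2) by auto
      then have in_d: "cell_of \<mu> T (Suc k) \<in> diagram \<mu>" and t: "T (cell_of \<mu> T (Suc k)) = Suc k"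
        using cell_of_entry(2,3)[OF assms(1), of "Suc k"] by auto
      have "snd (cell_of \<mu> T (Suc k)) - 1 = j" using k by (simp add: word_of_def)
      moreover have "1 \<le> snd (cell_of \<mu> T (Suc k))" using in_d by (auto simp: diagram_def)
      ultimately have "snd (cell_of \<mu> T (Suc k)) = Suc j" by simp
      then show ?thesis using in_d t by (metis prod.collapse)
    qed
    show "\<forall>k\<in>?A. T (fst (cell_of \<mu> T (Suc k)), Suc j) - 1 = k"
      using cell by (metis diff_Suc_1)
    show "(\<lambda>k. fst (cell_of \<mu> T (Suc k))) ` ?A \<subseteq> ?B"
    proof
      fix x assume "x \<in> (\<lambda>k. fst (cell_of \<mu> T (Suc k))) ` ?A"
      then obtain k where k: "k \<in> ?A" "x = fst (cell_of \<mu> T (Suc k))" by auto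
      have "(x, Suc j) = cell_of \<mu> T (Suc k)" using cell[OF k(1)] k(2) by simp
      then show "x \<in> ?B" using cell[OF k(1)] k(1) by simp
    qed
    have entry: "Suc (T (i, Suc j) - 1) = T (i, Suc j)" if "i \<in> ?B" for i
      using cell_of_entry(4)[OF assms(1), of "(i, Suc j)"] that by simp
    show "\<forall>i\<in>?B. fst (cell_of \<mu> T (Suc (T (i, Suc j) - 1))) = i"
      using entry cell_of_entry(1)[OF assms(1)] by simp
    show "(\<lambda>i. T (i, Suc j) - 1) ` ?B \<subseteq> ?A"
    proof
      fix k assume "k \<in> (\<lambda>i. T (i, Suc j) - 1) ` ?B"
      then obtain i where i: "i \<in> ?B" "k = T (i, Suc j) - 1" by auto
      then show "k \<in> ?A" using entry[OF i(1)] nth_word_of_entry[OF assms(1), of i "Suc j"] by auto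
    qed
  qed
  finally show ?thesis .
qed

lemma finite_row: "finite {i. (i, j) \<in> diagram \<mu> \<and> P i}"
  by (rule finite_subset[of _ "fst ` diagram \<mu>"]) (force simp: finite_diagram)+

lemma word_of_in_ballot_words:
  assumes "T \<in> SYT \<mu>" "is_partition \<mu> n"
  shows "word_of \<mu> T \<in> ballot_words (row_length \<mu>)"
proof -
  have dom: "dominant (take m (word_of \<mu> T))" if "m \<le> sum_list \<mu>" for m
    unfolding dominant_def count_word_of[OF assms(1) that]
  proof (intro allI card_mono finite_row subsetI)
    fix j i assume "i \<in> {i. (i, Suc (Suc j)) \<in> diagram \<mu> \<and> T (i, Suc (Suc j)) \<le> m}"
    then have i: "(i, Suc (Suc j)) \<in> diagram \<mu>" "T (i, Suc (Suc j)) \<le> m" by auto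
    have "(i, Suc j) \<in> diagram \<mu>"
      using i part_antimono[OF assms(2), of "Suc j" "Suc (Suc j)"] by (auto simp: mem_diagram)
    then show "i \<in> {i. (i, Suc j) \<in> diagram \<mu> \<and> T (i, Suc j) \<le> m}"
      using SYT_column[OF assms(1) _ i(1), of "Suc j"] i(2) by fastforce
  qed
  have "dominant (take m (word_of \<mu> T))" for m
    using dom[of m] dom[of "sum_list \<mu>"] by (cases "m \<le> sum_list \<mu>") auto
  moreover have "count_list (word_of \<mu> T) j = row_length \<mu> j" for j
  proof -
    have "count_list (word_of \<mu> T) j = card {i. (i, Suc j) \<in> diagram \<mu> \<and> T (i, Suc j) \<le> sum_list \<mu>}"
      using count_word_of[OF assms(1) order_refl] by simp
    also have "{i. (i, Suc j) \<in> diagram \<mu> \<and> T (i, Suc j) \<le> sum_list \<mu>} = {1..row_length \<mu> j}"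
      using cell_of_entry(4)[OF assms(1)] by (auto simp: mem_diagram row_length_def)
    finally show ?thesis by simp
  qed
  ultimately show ?thesis by (simp add: ballot_words_def ballot_def fun_eq_iff)
qed

text \<open>
  The cell of the entry \<open>m\<close> read off from the word: its column is the number of
  letters so far that are equal to the \<open>m\<close>-th one. As a function of \<open>m\<close>
  it is the inverse of the tableau with the word \<open>w\<close>.\<close>

definition word_cell :: "nat list \<Rightarrow> nat \<Rightarrow> nat \<times> nat" where
  "word_cell w m = (count_list (take m w) (w ! (m - 1)), Suc (w ! (m - 1)))"

lemma word_cell_word_of:
  assumes "T \<in> SYT \<mu>" "c \<in> diagram \<mu>"
  shows "word_cell (word_of \<mu> T) (T c) = c"
proof -
  obtain i j where c: "c = (i, Suc j)" using assms(2) by (cases c) (auto simp: diagram_def dest: Suc_le_D)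
  have d: "(i, Suc j) \<in> diagram \<mu>" using assms(2) c by simp
  have "{i'. (i', Suc j) \<in> diagram \<mu> \<and> T (i', Suc j) \<le> T (i, Suc j)} = {1..i}"
  proof -
    have "T (i', Suc j) \<le> T (i, Suc j) \<longleftrightarrow> i' \<le> i" if "(i', Suc j) \<in> diagram \<mu>" for i'
      using SYT_row[OF assms(1) that d] SYT_row[OF assms(1) d that]
      by (cases i' i rule: linorder_cases) auto
    then show ?thesis using d by (auto simp: mem_diagram)
  qed
  then have "count_list (take (T (i, Suc j)) (word_of \<mu> T)) j = i"
    using count_word_of[OF assms(1)] cell_of_entry(4)[OF assms(1) d] by simp
  then show ?thesis using nth_word_of_entry[OF assms(1) d] by (simp add: word_cell_def c)
qed

lemma inj_on_word_of: "inj_on (word_of \<mu>) (SYT \<mu>)"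
proof (rule inj_onI)
  fix T U assume T: "T \<in> SYT \<mu>" and U: "U \<in> SYT \<mu>" and eq: "word_of \<mu> T = word_of \<mu> U"
  have "T \<in> extensional (diagram \<mu>)" "U \<in> extensional (diagram \<mu>)" using T U by (auto simp: SYT_def)
  moreover have "T c = U c" if c: "c \<in> diagram \<mu>" for c
  proof -
    have tc: "1 \<le> T c" "T c \<le> sum_list \<mu>" using cell_of_entry(4)[OF T c] by auto
    let ?d = "cell_of \<mu> U (T c)"
    have d: "?d \<in> diagram \<mu>" "U ?d = T c" using cell_of_entry(2,3)[OF U tc] by auto
    have "c = word_cell (word_of \<mu> U) (T c)" using word_cell_word_of[OF T c] eq by simp
    also have "\<dots> = ?d" using word_cell_word_of[OF U d(1)] d(2) by simp
    finally show ?thesis using d(2) by simp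
  qed
  ultimately show "T = U" by (rule extensionalityI)
qed

lemma count_list_take_mono: "m \<le> m' \<Longrightarrow> count_list (take m w) x \<le> count_list (take m' w) x"
  by (metis append_take_drop_id count_list_append le_add1 min.absorb2 take_take min.commute)

lemma count_list_take_less:
  assumes "m < m'" "m' \<le> length w"
  shows "count_list (take m w) (w ! (m' - 1)) < count_list (take m' w) (w ! (m' - 1))"
proof -
  obtain k where k: "m' = Suc k" using assms(1) by (cases m') auto
  have "count_list (take m w) (w ! k) \<le> count_list (take k w) (w ! k)"
    using assms(1) k by (intro count_list_take_mono) simp
  also have "\<dots> < count_list (take (Suc k) w) (w ! k)"
    using assms(2) k by (simp add: take_Suc_conv_app_nth)
  finally show ?thesis using k by simp
qed

lemma word_cell_bij:
  assumes "is_partition \<mu> n" "w \<in> ballot_words (row_length \<mu>)"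
  shows "bij_betw (word_cell w) {1..sum_list \<mu>} (diagram \<mu>)" and "length w = sum_list \<mu>"
proof -
  have supp: "\<forall>i\<ge>length \<mu>. row_length \<mu> i = 0"
    using shape_row_length[OF assms(1)] by (simp add: shape_def)
  have cw: "count_list w = row_length \<mu>" using assms(2) by (simp add: ballot_words_def)
  show len: "length w = sum_list \<mu>" using length_ballot_word(2)[OF supp cw] sum_row_length by simp
  have less: "fst (word_cell w m) < fst (word_cell w m')"
    if "m < m'" "m' \<le> sum_list \<mu>" "snd (word_cell w m) = snd (word_cell w m')" for m m'
    using count_list_take_less[of m m' w] that len by (simp add: word_cell_def)
  have inj: "inj_on (word_cell w) {1..sum_list \<mu>}"
  proof (rule inj_onI)
    fix m m' assume "m \<in> {1..sum_list \<mu>}" "m' \<in> {1..sum_list \<mu>}" "word_cell w m = word_cell w m'"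
    then show "m = m'" using less[of m m'] less[of m' m] by (cases m m' rule: linorder_cases) auto
  qed
  have "word_cell w ` {1..sum_list \<mu>} \<subseteq> diagram \<mu>"
  proof clarify
    fix a b m assume e: "(a, b) = word_cell w m" and m: "m \<in> {1..sum_list \<mu>}"
    have "count_list (take m w) (w ! (m - 1)) \<le> count_list w (w ! (m - 1))"
      using count_list_take_mono[of m "length w" w] m len by simp
    moreover have "0 < count_list (take m w) (w ! (m - 1))"
      using count_list_take_less[of 0 m w] m len by simp
    ultimately show "(a, b) \<in> diagram \<mu>"
      using e cw by (auto simp: word_cell_def mem_diagram row_length_def)
  qed
  then have "word_cell w ` {1..sum_list \<mu>} = diagram \<mu>"
    using card_image[OF inj] by (intro card_subset_eq finite_diagram) (simp_all add: card_diagram)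
  then show "bij_betw (word_cell w) {1..sum_list \<mu>} (diagram \<mu>)" using inj by (simp add: bij_betw_def)
qed

text \<open>
  The ballot condition makes columns increase: when the \<open>i\<close>-th cell of a lower row is
  filled, the row above already has \<open>i\<close> cells.\<close>

lemma word_of_surj:
  assumes "is_partition \<mu> n" "w \<in> ballot_words (row_length \<mu>)"
  shows "w \<in> word_of \<mu> ` SYT \<mu>"
proof -
  let ?N = "{1..sum_list \<mu>}"
  note S = word_cell_bij[OF assms]
  have S_inj: "inj_on (word_cell w) ?N" and S_im: "word_cell w ` ?N = diagram \<mu>"
    using S(1) by (auto simp: bij_betw_def)
  define T where "T = restrict (inv_into ?N (word_cell w)) (diagram \<mu>)"
  have T1: "T c \<in> ?N" "word_cell w (T c) = c" if "c \<in> diagram \<mu>" for c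
    using that inv_into_into[of c "word_cell w" ?N] f_inv_into_f[of c "word_cell w" ?N]
    unfolding S_im T_def by simp_all
  have T2: "T (word_cell w m) = m" if "m \<in> ?N" for m
    using that S_im S_inj by (auto simp: T_def)
  have bij: "bij_betw T (diagram \<mu>) ?N"
    using bij_betw_inv_into[OF S(1)] by (rule bij_betw_cong[THEN iffD1, rotated]) (simp add: T_def)
  have val: "i = count_list (take (T (i, j)) w) (j - 1)" "j = Suc (w ! (T (i, j) - 1))"
    if "(i, j) \<in> diagram \<mu>" for i j
  proof -
    have c: "count_list (take (T (i, j)) w) (w ! (T (i, j) - 1)) = i" and r: "Suc (w ! (T (i, j) - 1)) = j"
      using T1(2)[OF that] by (auto simp: word_cell_def)
    show "j = Suc (w ! (T (i, j) - 1))" using r by simp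
    have "w ! (T (i, j) - 1) = j - 1" using r by simp
    then show "i = count_list (take (T (i, j)) w) (j - 1)" using c by simp
  qed
  have row: "T (i, j) < T (i', j)" if "(i, j) \<in> diagram \<mu>" "(i', j) \<in> diagram \<mu>" "i < i'" for i i' j
  proof (rule ccontr)
    assume "\<not> T (i, j) < T (i', j)"
    then have "i' \<le> i"
      using val(1)[OF that(1)] val(1)[OF that(2)] count_list_take_mono[of "T (i', j)" "T (i, j)" w "j - 1"] by simp
    then show False using that(3) by simp
  qed
  have dom: "count_list (take m w) (Suc k) \<le> count_list (take m w) k" for m k
    using assms(2) by (auto simp: ballot_words_def ballot_def dominant_def)
  have col: "T (i, j) < T (i, j')" if d: "(i, j) \<in> diagram \<mu>" "(i, j') \<in> diagram \<mu>" "j < j'" for i j j'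
  proof -
    have anti: "antimono (count_list (take m w))" for m using dom by (simp add: antimono_iff_le_Suc)
    have "\<not> T (i, j') < T (i, j)"
    proof
      assume less: "T (i, j') < T (i, j)"
      have "i = count_list (take (T (i, j')) w) (j' - 1)" by (rule val(1)[OF d(2)])
      also have "\<dots> \<le> count_list (take (T (i, j')) w) (j - 1)" using d(3) by (intro antimonoD[OF anti]) simp
      also have "\<dots> < count_list (take (T (i, j)) w) (j - 1)"
      proof -
        have "T (i, j) \<le> length w" using T1(1)[OF d(1)] S(2) by simp
        moreover have "w ! (T (i, j) - 1) = j - 1" using val(2)[OF d(1)] by simp
        ultimately show ?thesis using count_list_take_less[OF less, of w] by simp
      qed
      also have "\<dots> = i" using val(1)[OF d(1)] by simp
      finally show False by simp
    qed
    moreover have "T (i, j') \<noteq> T (i, j)" using val(2)[OF d(1)] val(2)[OF d(2)] d(3) by auto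
    ultimately show ?thesis by simp
  qed
  have T: "T \<in> SYT \<mu>" using bij row col by (auto simp: SYT_def T_def)
  have "word_of \<mu> T = w"
  proof (rule nth_equalityI)
    fix k assume "k < length (word_of \<mu> T)"
    then have k: "Suc k \<in> ?N" by simp
    have "word_cell w (Suc k) \<in> diagram \<mu>" using S_im k by blast
    then have "(fst (word_cell w (Suc k)), Suc (w ! k)) \<in> diagram \<mu>" by (simp add: word_cell_def)
    from nth_word_of_entry[OF T this] T2[OF k] show "word_of \<mu> T ! k = w ! k"
      by (simp add: word_cell_def)
  qed (simp add: S(2))
  then show ?thesis using T by blast
qed

lemma bij_betw_word_of:
  "is_partition \<mu> n \<Longrightarrow> bij_betw (word_of \<mu>) (SYT \<mu>) (ballot_words (row_length \<mu>))"
  unfolding bij_betw_def using inj_on_word_of word_of_in_ballot_words word_of_surj by blast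

text \<open>
  If \<open>m + 1\<close> were strictly south and strictly east of \<open>m\<close>, or weakly
  north and weakly west, an intermediate cell would contradict that the entries are consecutive.
  This gives the two descriptions of a descent, by rows and by columns, that are exchanged by
  transposition.\<close>

lemma consecutive_cells:
  assumes "T \<in> SYT \<mu>" "is_partition \<mu> n" "(i, j) \<in> diagram \<mu>" "(i', j') \<in> diagram \<mu>"
    and "T (i', j') = T (i, j) + 1"
  shows "j < j' \<longleftrightarrow> i' \<le> i"
proof
  assume jj: "j < j'"
  show "i' \<le> i"
  proof (rule ccontr)
    assume "\<not> i' \<le> i"
    have mid: "(i', j) \<in> diagram \<mu>"
      using assms(3,4) part_antimono[OF assms(2), of j j'] jj by (auto simp: mem_diagram)
    have "T (i, j) < T (i', j)" using SYT_row[OF assms(1,3) mid] \<open>\<not> i' \<le> i\<close> by simp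
    moreover have "T (i', j) < T (i', j')" by (rule SYT_column[OF assms(1) mid assms(4) jj])
    ultimately show False using assms(5) by simp
  qed
next
  assume ii: "i' \<le> i"
  show "j < j'"
  proof (rule ccontr)
    assume "\<not> j < j'"
    then have le: "j' \<le> j" by simp
    have mid: "(i, j') \<in> diagram \<mu>"
      using assms(3,4) part_antimono[OF assms(2), of j' j] le by (auto simp: mem_diagram)
    have "T (i', j') \<le> T (i, j')"
      using SYT_row[OF assms(1,4) mid] ii by (cases "i' = i") auto
    moreover have "T (i, j') \<le> T (i, j)"
      using SYT_column[OF assms(1) mid assms(3)] le by (cases "j' = j") auto
    ultimately show False using assms(5) by simp
  qed
qed

lemma mem_descents_iff:
  assumes "T \<in> SYT \<mu>" "is_partition \<mu> n" "(i, j) \<in> diagram \<mu>" "(i', j') \<in> diagram \<mu>"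
    and "T (i', j') = T (i, j) + 1"
  shows "T (i, j) \<in> descents \<mu> T \<longleftrightarrow> j < j'"
proof
  assume "T (i, j) \<in> descents \<mu> T"
  then obtain a b a' b' where "(a, b) \<in> diagram \<mu>" "(a', b') \<in> diagram \<mu>"
    "T (a, b) = T (i, j)" "T (a', b') = T (i, j) + 1" "b < b'"
    by (auto simp: descents_def)
  then have "(a, b) = (i, j)" "(a', b') = (i', j')"
    using cell_of_entry(1)[OF assms(1)] assms(3-5) by metis+
  then show "j < j'" using \<open>b < b'\<close> by simp
next
  assume "j < j'"
  then show "T (i, j) \<in> descents \<mu> T"
    using consecutive_cells[OF assms] assms(3-5) cell_of_entry(4)[OF assms(1,3)] cell_of_entry(4)[OF assms(1,4)]
    by (auto simp: descents_def)
qed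

lemma descents_asc:
  assumes "T \<in> SYT \<mu>" "is_partition \<mu> n"
  shows "Suc k \<in> descents \<mu> T \<longleftrightarrow> asc (word_of \<mu> T) k"
proof (cases "Suc k < sum_list \<mu>")
  case True
  obtain i j where ij: "cell_of \<mu> T (Suc k) = (i, j)" by fastforce
  obtain i' j' where ij': "cell_of \<mu> T (Suc (Suc k)) = (i', j')" by fastforce
  have d: "(i, j) \<in> diagram \<mu>" "T (i, j) = Suc k"
    using cell_of_entry(2,3)[OF assms(1), of "Suc k"] True ij by auto
  have d': "(i', j') \<in> diagram \<mu>" "T (i', j') = Suc (Suc k)"
    using cell_of_entry(2,3)[OF assms(1), of "Suc (Suc k)"] True ij' by auto
  have "Suc k \<in> descents \<mu> T \<longleftrightarrow> j < j'"
    using mem_descents_iff[OF assms d(1) d'(1)] d(2) d'(2) by simp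
  moreover have "word_of \<mu> T ! k = j - 1" "word_of \<mu> T ! Suc k = j' - 1"
    using True ij ij' by (simp_all add: word_of_def)
  moreover have "1 \<le> j" "1 \<le> j'" using d(1) d'(1) by (auto simp: mem_diagram)
  ultimately show ?thesis using True by (auto simp: asc_def)
qed (auto simp: descents_def asc_def)

lemma finite_SYT: "is_partition \<mu> n \<Longrightarrow> finite (SYT \<mu>)"
  using bij_betw_finite[OF bij_betw_word_of] finite_ballot_words[of "length \<mu>" "row_length \<mu>"]
    shape_row_length by (auto simp: shape_def)

lemma card_SYT: "is_partition \<mu> n \<Longrightarrow> card (SYT \<mu>) = card (ballot_words (row_length \<mu>))"
  by (rule bij_betw_same_card[OF bij_betw_word_of])

lemma card_SYT_word:
  assumes "is_partition \<mu> n"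
  shows "card {T \<in> SYT \<mu>. P (word_of \<mu> T)} = card {w \<in> ballot_words (row_length \<mu>). P w}"
proof (rule bij_betw_same_card[of "word_of \<mu>"])
  show "bij_betw (word_of \<mu>) {T \<in> SYT \<mu>. P (word_of \<mu> T)} {w \<in> ballot_words (row_length \<mu>). P w}"
    using bij_betw_word_of[OF assms] unfolding bij_betw_def by (auto intro: inj_on_subset)
qed

lemma row_word_facts:
  assumes "is_partition \<mu> n"
  shows "finite (ballot_words (row_length \<mu>))"
    and "w \<in> ballot_words (row_length \<mu>) \<Longrightarrow> length w = n"
  using finite_ballot_words[of "length \<mu>" "row_length \<mu>"] shape_row_length[OF assms]
    word_cell_bij(2)[OF assms] assms by (auto simp: shape_def is_partition_def)

section \<open>Transposition\<close>

definition transpose_tableau :: "nat list \<Rightarrow> (nat \<times> nat \<Rightarrow> nat) \<Rightarrow> nat \<times> nat \<Rightarrow> nat" where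
  "transpose_tableau \<mu> T = restrict (\<lambda>c. T (prod.swap c)) (prod.swap ` diagram \<mu>)"

lemma transpose_tableau_SYT:
  assumes "T \<in> SYT \<mu>" "diagram \<mu>' = prod.swap ` diagram \<mu>" "sum_list \<mu>' = sum_list \<mu>"
  shows "transpose_tableau \<mu> T \<in> SYT \<mu>'"
proof -
  have mem: "(i, j) \<in> diagram \<mu>' \<longleftrightarrow> (j, i) \<in> diagram \<mu>" for i j unfolding assms(2) by force
  have ap: "transpose_tableau \<mu> T (i, j) = T (j, i)" if "(j, i) \<in> diagram \<mu>" for i j
    using that by (force simp: transpose_tableau_def)
  have "bij_betw prod.swap (diagram \<mu>') (diagram \<mu>)"
    unfolding assms(2) by (rule bij_betw_byWitness[where f' = prod.swap]) auto
  then have "bij_betw (T \<circ> prod.swap) (diagram \<mu>') {1..sum_list \<mu>}"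
    using SYT_bij[OF assms(1)] by (rule bij_betw_trans)
  then have "bij_betw (transpose_tableau \<mu> T) (diagram \<mu>') {1..sum_list \<mu>'}"
    unfolding assms(3) by (rule bij_betw_cong[THEN iffD1, rotated]) (auto simp: mem ap)
  moreover have "transpose_tableau \<mu> T \<in> extensional (diagram \<mu>')"
    by (simp add: transpose_tableau_def assms(2))
  ultimately show ?thesis
    using SYT_row[OF assms(1)] SYT_column[OF assms(1)] by (simp add: SYT_def mem ap)
qed

lemma transpose_tableau_involution:
  assumes "T \<in> SYT \<mu>" "diagram \<mu>' = prod.swap ` diagram \<mu>"
  shows "transpose_tableau \<mu>' (transpose_tableau \<mu> T) = T"
proof (rule extensionalityI)
  have d: "prod.swap ` diagram \<mu>' = diagram \<mu>" unfolding assms(2) by (simp add: image_image)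
  show "transpose_tableau \<mu>' (transpose_tableau \<mu> T) \<in> extensional (diagram \<mu>)"
    by (simp add: transpose_tableau_def d)
  show "T \<in> extensional (diagram \<mu>)" using assms(1) by (simp add: SYT_def)
  fix c assume "c \<in> diagram \<mu>"
  then show "transpose_tableau \<mu>' (transpose_tableau \<mu> T) c = T c"
    by (simp add: transpose_tableau_def d)
qed

lemma descents_transpose:
  assumes "T \<in> SYT \<mu>" "is_partition \<mu> n" "1 \<le> m" "m < sum_list \<mu>"
  shows "m \<in> descents (conjugate \<mu>) (transpose_tableau \<mu> T) \<longleftrightarrow> m \<notin> descents \<mu> T"
proof -
  let ?U = "transpose_tableau \<mu> T"
  have U: "?U \<in> SYT (conjugate \<mu>)"
    by (rule transpose_tableau_SYT[OF assms(1) diagram_conjugate[OF assms(2)] sum_list_conjugate[OF assms(2)]])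
  have mem: "(j, i) \<in> diagram (conjugate \<mu>) \<and> ?U (j, i) = T (i, j)" if "(i, j) \<in> diagram \<mu>" for i j
    using that mem_diagram_conjugate[OF assms(2)] by (force simp: transpose_tableau_def)
  obtain i j where ij: "cell_of \<mu> T m = (i, j)" by fastforce
  obtain i' j' where ij': "cell_of \<mu> T (m + 1) = (i', j')" by fastforce
  have d: "(i, j) \<in> diagram \<mu>" "T (i, j) = m"
    using cell_of_entry(2,3)[OF assms(1), of m] assms ij by auto
  have d': "(i', j') \<in> diagram \<mu>" "T (i', j') = m + 1"
    using cell_of_entry(2,3)[OF assms(1), of "m + 1"] assms ij' by auto
  have "m \<in> descents \<mu> T \<longleftrightarrow> j < j'" "j < j' \<longleftrightarrow> i' \<le> i"
    using mem_descents_iff[OF assms(1,2) d(1) d'(1)] consecutive_cells[OF assms(1,2) d(1) d'(1)] d(2) d'(2) by auto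
  moreover have "m \<in> descents (conjugate \<mu>) ?U \<longleftrightarrow> i < i'"
    using mem_descents_iff[OF U is_partition_conjugate[OF assms(2)], of j i j' i'] mem[OF d(1)] mem[OF d'(1)] d(2) d'(2)
    by auto
  ultimately show ?thesis by auto
qed

section \<open>The hook length formula\<close>

text \<open>
  The hook lengths of row \<open>j\<close> and the differences \<open>\<beta>\<^sub>j -
  \<beta>\<^sub>l\<close> for the rows \<open>l\<close> below it are disjoint and together exhaust
  \<open>{1, \<dots>, \<beta>\<^sub>j}\<close>: both families are injective, and their sizes add
  up to \<open>\<beta>\<^sub>j\<close>.\<close>

lemma row_hooks:
  assumes "is_partition \<mu> n" "j < length \<mu>"
  defines "a \<equiv> row_length \<mu>" and "r \<equiv> length \<mu>"
  shows "(\<Prod>i<a j. real (part (conjugate \<mu>) (Suc i)) + real (a j) - real (Suc i) - real (Suc j) + 1)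
      * (\<Prod>l\<in>{j<..<r}. beta a r j - beta a r l) = fact (a j + (r - Suc j))"
proof -
  let ?c = "\<lambda>i. part (conjugate \<mu>) (Suc i)"
  have anti: "antimono a" using shape_row_length[OF assms(1)] by (simp add: shape_def a_def)
  have col: "Suc l \<le> ?c i \<longleftrightarrow> i < a l" for i l
  proof -
    have "Suc l \<in> {j. (Suc i, j) \<in> diagram \<mu>} \<longleftrightarrow> Suc l \<in> {1..?c i}"
      using column_eq[OF assms(1), of "Suc i"] by simp
    then show ?thesis by (auto simp: mem_diagram a_def row_length_def)
  qed
  have c_le: "?c i \<le> r" for i
  proof (rule ccontr)
    assume "\<not> ?c i \<le> r"
    then have "i < a r" using col[of r i] by simp
    then show False by (simp add: a_def r_def row_length_eq)
  qed
  \<comment> \<open>Hooks and differences in natural numbers, written so that each truncated subtraction is exact.\<close>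
  define H where "H i = (a j - Suc i) + (?c i - Suc j) + 1" for i
  define g where "g l = (a j - a l) + (l - j)" for l
  have cj: "Suc j \<le> ?c i" if "i < a j" for i using col that by simp
  have H_less: "H i' < H i" if "i < i'" "i' < a j" for i i'
  proof -
    have "?c i' \<le> ?c i"
    proof (rule ccontr)
      assume "\<not> ?c i' \<le> ?c i"
      then have "Suc (?c i) \<le> ?c i'" by simp
      then have "i' < a (?c i)" by (rule col[THEN iffD1])
      then have "i < a (?c i)" using that(1) by simp
      then have "Suc (?c i) \<le> ?c i" by (rule col[THEN iffD2])
      then show False by simp
    qed
    then show ?thesis using that by (simp add: H_def)
  qed
  have g_less: "g l < g l'" if "j < l" "l < l'" for l l'
    using antimonoD[OF anti, of l l'] that by (simp add: g_def)
  have H_inj: "inj_on H {..<a j}"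
    by (rule inj_onI) (metis H_less lessThan_iff less_irrefl linorder_neqE_nat)
  have g_inj: "inj_on g {j<..<r}"
    by (rule inj_onI) (metis g_less greaterThanLessThan_iff less_irrefl linorder_neqE_nat)
  have H_g: "H i \<noteq> g l" if "i < a j" "j < l" for i l
  proof (cases "i < a l")
    case True
    then have "Suc l \<le> ?c i" by (rule col[THEN iffD2])
    then show ?thesis using True that antimonoD[OF anti, of j l] by (simp add: H_def g_def)
  next
    case False
    then have "?c i \<le> l" using col[of l i] by simp
    then show ?thesis using False that cj[OF that(1)] by (simp add: H_def g_def)
  qed
  have disj: "H ` {..<a j} \<inter> g ` {j<..<r} = {}" using H_g by auto
  have jr: "j < r" using assms(2) by (simp add: r_def)
  have sub: "H ` {..<a j} \<union> g ` {j<..<r} \<subseteq> {1..a j + (r - Suc j)}"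
  proof -
    have "H i \<in> {1..a j + (r - Suc j)}" if "i < a j" for i
      using c_le[of i] that jr by (simp add: H_def)
    moreover have "g l \<in> {1..a j + (r - Suc j)}" if "j < l" "l < r" for l
    proof -
      have "1 \<le> l - j" "l - j \<le> r - Suc j" "a j - a l \<le> a j" using that by linarith+
      then show ?thesis unfolding g_def atLeastAtMost_iff by linarith
    qed
    ultimately show ?thesis by auto
  qed
  have "card (H ` {..<a j} \<union> g ` {j<..<r}) = a j + (r - Suc j)"
    using disj by (simp add: card_Un_disjoint card_image[OF H_inj] card_image[OF g_inj])
  then have all: "H ` {..<a j} \<union> g ` {j<..<r} = {1..a j + (r - Suc j)}"
    by (intro card_subset_eq sub) auto
  have "(fact (a j + (r - Suc j)) :: real) = (\<Prod>x\<in>H ` {..<a j} \<union> g ` {j<..<r}. real x)"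
    unfolding all by (simp add: fact_prod)
  also have "\<dots> = (\<Prod>i<a j. real (H i)) * (\<Prod>l\<in>{j<..<r}. real (g l))"
    using disj by (simp add: prod.union_disjoint prod.reindex[OF H_inj] prod.reindex[OF g_inj])
  also have "(\<Prod>i<a j. real (H i))
      = (\<Prod>i<a j. real (?c i) + real (a j) - real (Suc i) - real (Suc j) + 1)"
  proof (rule prod.cong)
    fix i assume "i \<in> {..<a j}"
    then show "real (H i) = real (?c i) + real (a j) - real (Suc i) - real (Suc j) + 1"
      using cj[of i] by (simp add: H_def of_nat_diff)
  qed simp
  also have "(\<Prod>l\<in>{j<..<r}. real (g l)) = (\<Prod>l\<in>{j<..<r}. beta a r j - beta a r l)"
  proof (rule prod.cong)
    fix l assume "l \<in> {j<..<r}"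
    then have "a l \<le> a j" "j \<le> l" using antimonoD[OF anti, of j l] by auto
    then have "real (g l) = (real (a j) - real (a l)) + (real l - real j)"
      unfolding g_def of_nat_add by (simp only: of_nat_diff)
    then show "real (g l) = beta a r j - beta a r l" by (simp add: beta_def)
  qed simp
  finally show ?thesis by simp
qed

lemma hook_length_formula:
  assumes "is_partition \<mu> n"
  shows "real (card (SYT \<mu>)) = fact n * (\<Prod>(i, j)\<in>diagram \<mu>.
    inverse (real (part (conjugate \<mu>) i) + real (part \<mu> j) - real i - real j + 1))"
proof -
  let ?a = "row_length \<mu>" and ?r = "length \<mu>"
  let ?hook = "\<lambda>i j. real (part (conjugate \<mu>) i) + real (part \<mu> j) - real i - real j + 1"
  have anti: "antimono ?a" using shape_row_length[OF assms] by (simp add: shape_def)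
  have "(\<Prod>(i, j)\<in>diagram \<mu>. inverse (?hook i j))
      = (\<Prod>z\<in>Sigma {..<?r} (\<lambda>j. {..<?a j}). (\<lambda>(i, j). inverse (?hook i j)) ((\<lambda>(j, i). (Suc i, Suc j)) z))"
    by (rule prod.reindex_bij_betw[symmetric, OF bij_betw_diagram])
  also have "\<dots> = (\<Prod>j<?r. \<Prod>i<?a j. inverse (?hook (Suc i) (Suc j)))"
    by (subst prod.Sigma) (auto intro!: prod.cong)
  also have "\<dots> = frobenius ?a ?r"
    unfolding frobenius_def
  proof (rule prod.cong)
    fix j assume "j \<in> {..<?r}"
    then have j: "j < ?r" by simp
    let ?P = "\<Prod>i<?a j. ?hook (Suc i) (Suc j)"
    let ?D = "\<Prod>l\<in>{j<..<?r}. beta ?a ?r j - beta ?a ?r l"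
    have rh: "?P * ?D = fact (?a j + (?r - Suc j))"
      using row_hooks[OF assms j] by (simp add: row_length_def)
    have cancel: "inverse P = D / (P * D)" if "P * D \<noteq> 0" for P D :: real
      using that by (simp add: field_simps)
    have "inverse ?P = ?D / (?P * ?D)" by (rule cancel) (simp only: rh fact_nonzero not_False_eq_True)
    then show "(\<Prod>i<?a j. inverse (?hook (Suc i) (Suc j))) = ?D / fact (?a j + (?r - Suc j))"
      unfolding rh prod_inversef[symmetric] o_def .
  qed simp
  finally show ?thesis
    using card_ballot_words[OF shape_row_length[OF assms]] card_SYT[OF assms] assms
    by (simp add: sum_row_length is_partition_def)
qed

lemma frobenius_pos: "antimono a \<Longrightarrow> frobenius a r > 0"
  unfolding frobenius_def by (intro prod_pos divide_pos_pos) (auto simp: beta_less)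

lemma SYT_nonempty:
  assumes "is_partition \<mu> n"
  shows "SYT \<mu> \<noteq> {}"
proof -
  have "real (card (SYT \<mu>)) > 0"
    using card_ballot_words[OF shape_row_length[OF assms]] card_SYT[OF assms]
      frobenius_pos[of "row_length \<mu>"] shape_row_length[OF assms] by (simp add: shape_def)
  then show ?thesis by force
qed

section \<open>The coefficients as values of shifted complete functions\<close>

definition row_hstar :: "nat list \<Rightarrow> nat \<Rightarrow> real" where
  "row_hstar \<mu> k = hstar (\<lambda>i. real (row_length \<mu> i)) (length \<mu>) k 0"

lemma hstar_2_sum:
  "(\<Sum>(i, j)\<in>{(i, j). 1 \<le> j \<and> j \<le> i \<and> i \<le> length \<mu>}.
      real (part \<mu> i) * (real (part \<mu> j) - 1) / D) = row_hstar \<mu> 2 / D"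
proof -
  let ?r = "length \<mu>" and ?x = "\<lambda>i. real (row_length \<mu> i)"
  have "(\<Sum>(i, j)\<in>{(i, j). 1 \<le> j \<and> j \<le> i \<and> i \<le> ?r}. real (part \<mu> i) * (real (part \<mu> j) - 1) / D)
    = (\<Sum>(q, p)\<in>(SIGMA q:{0..<?r}. {q..<?r}). ?x p * (?x q - 1) / D)"
    by (rule sum.reindex_bij_witness[of _ "\<lambda>(q, p). (Suc p, Suc q)" "\<lambda>(i, j). (j - 1, i - 1)"])
       (auto simp: row_length_def)
  also have "\<dots> = row_hstar \<mu> 2 / D"
    by (simp add: row_hstar_def numeral_2_eq_2 sum.Sigma[symmetric] sum_distrib_left sum_divide_distrib mult.commute)
  finally show ?thesis .
qed

text \<open>
  The restriction to positive terms in \<open>d\<close> and \<open>e\<close> only discards zeros: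
  a negative last factor forces the parts to be so small that an earlier factor vanishes.\<close>

lemma row_hstar_nonneg_terms:
  assumes "is_partition \<mu> n" "1 \<le> k" "k \<le> j" "j \<le> i" "i \<le> length \<mu>"
  shows "0 \<le> real (part \<mu> i) * (real (part \<mu> j) - 1) * (real (part \<mu> k) - 2)"
    and "1 \<le> l \<Longrightarrow> l \<le> k \<Longrightarrow>
      0 \<le> real (part \<mu> i) * (real (part \<mu> j) - 1) * (real (part \<mu> k) - 2) * (real (part \<mu> l) - 3)"
proof -
  have pos: "1 \<le> part \<mu> i" using assms by (auto simp: part_def is_partition_def Suc_le_eq)
  have ij: "part \<mu> i \<le> part \<mu> j" "part \<mu> j \<le> part \<mu> k"
    using part_antimono[OF assms(1)] assms(2-4) by auto
  show t: "0 \<le> real (part \<mu> i) * (real (part \<mu> j) - 1) * (real (part \<mu> k) - 2)"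
  proof (cases "part \<mu> j = 1")
    case False
    then have "0 \<le> real (part \<mu> j) - 1" "0 \<le> real (part \<mu> k) - 2" using pos ij by linarith+
    then show ?thesis by simp
  qed simp
  assume "1 \<le> l" "l \<le> k"
  then have kl: "part \<mu> k \<le> part \<mu> l" using part_antimono[OF assms(1)] by auto
  show "0 \<le> real (part \<mu> i) * (real (part \<mu> j) - 1) * (real (part \<mu> k) - 2) * (real (part \<mu> l) - 3)"
  proof (cases "part \<mu> j = 1 \<or> part \<mu> k = 2")
    case False
    then have "0 \<le> real (part \<mu> l) - 3" using pos ij kl by linarith
    then show ?thesis using t by simp
  qed auto
qed

lemma d_coeff_eq:
  assumes "is_partition \<mu> n"
  shows "d_coeff \<mu> = row_hstar \<mu> 3 / (real n * (real n - 1) * (real n - 2))"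
proof -
  let ?r = "length \<mu>" and ?x = "\<lambda>i. real (row_length \<mu> i)"
  let ?D = "real n * (real n - 1) * (real n - 2)"
  let ?t = "\<lambda>(i, j, k). real (part \<mu> i) * (real (part \<mu> j) - 1) * (real (part \<mu> k) - 2)"
  let ?A = "{(i, j, k). 1 \<le> k \<and> k \<le> j \<and> j \<le> i \<and> i \<le> ?r}"
  let ?S = "SIGMA q1:{0..<?r}. SIGMA q2:{q1..<?r}. {q2..<?r}"
  have fin: "finite ?A" by (rule finite_subset[of _ "{..?r} \<times> {..?r} \<times> {..?r}"]) auto
  have "d_coeff \<mu> = (\<Sum>z\<in>{z \<in> ?A. 0 < ?t z}. ?t z / ?D)"
    using assms unfolding d_coeff_def is_partition_def Let_def
    by (intro sum.cong) auto
  also have "\<dots> = (\<Sum>z\<in>?A. ?t z / ?D)"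
  proof (rule sum.mono_neutral_left[OF fin])
    show "\<forall>z\<in>?A - {z \<in> ?A. 0 < ?t z}. ?t z / ?D = 0"
    proof
      fix z assume z: "z \<in> ?A - {z \<in> ?A. 0 < ?t z}"
      obtain i j k where zz: "z = (i, j, k)" by (cases z) auto
      then have "0 \<le> ?t z" using z row_hstar_nonneg_terms(1)[OF assms, of k j i] by auto
      then have "?t z = 0" using z by auto
      then show "?t z / ?D = 0" by simp
    qed
  qed auto
  also have "\<dots> = (\<Sum>(q1, q2, q3)\<in>?S. ?x q3 * (?x q2 - 1) * (?x q1 - 2) / ?D)"
    by (rule sum.reindex_bij_witness[of _ "\<lambda>(q1, q2, q3). (Suc q3, Suc q2, Suc q1)" "\<lambda>(i, j, k). (k - 1, j - 1, i - 1)"])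
       (auto simp: row_length_def)
  also have "\<dots> = (\<Sum>q1\<in>{0..<?r}. \<Sum>q2\<in>{q1..<?r}. \<Sum>q3\<in>{q2..<?r}. ?x q3 * (?x q2 - 1) * (?x q1 - 2) / ?D)"
    by (simp add: sum.Sigma)
  also have "\<dots> = row_hstar \<mu> 3 / ?D"
    unfolding row_hstar_def numeral_3_eq_3 hstar.simps sum_distrib_left sum_divide_distrib
    by (intro sum.cong refl) simp
  finally show ?thesis .
qed

lemma e_coeff_eq:
  assumes "is_partition \<mu> n"
  shows "e_coeff \<mu> = row_hstar \<mu> 4 / (real n * (real n - 1) * (real n - 2) * (real n - 3))"
proof -
  let ?r = "length \<mu>" and ?x = "\<lambda>i. real (row_length \<mu> i)"
  let ?D = "real n * (real n - 1) * (real n - 2) * (real n - 3)"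
  let ?t = "\<lambda>(i, j, k, l). real (part \<mu> i) * (real (part \<mu> j) - 1) * (real (part \<mu> k) - 2) * (real (part \<mu> l) - 3)"
  let ?A = "{(i, j, k, l). 1 \<le> l \<and> l \<le> k \<and> k \<le> j \<and> j \<le> i \<and> i \<le> ?r}"
  have four: "(4::nat) = Suc (Suc (Suc (Suc 0)))" by simp
  let ?S = "SIGMA q1:{0..<?r}. SIGMA q2:{q1..<?r}. SIGMA q3:{q2..<?r}. {q3..<?r}"
  have fin: "finite ?A" by (rule finite_subset[of _ "{..?r} \<times> {..?r} \<times> {..?r} \<times> {..?r}"]) auto
  have "e_coeff \<mu> = (\<Sum>z\<in>{z \<in> ?A. 0 < ?t z}. ?t z / ?D)"
    using assms unfolding e_coeff_def is_partition_def Let_def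
    by (intro sum.cong) auto
  also have "\<dots> = (\<Sum>z\<in>?A. ?t z / ?D)"
  proof (rule sum.mono_neutral_left[OF fin])
    show "\<forall>z\<in>?A - {z \<in> ?A. 0 < ?t z}. ?t z / ?D = 0"
    proof
      fix z assume z: "z \<in> ?A - {z \<in> ?A. 0 < ?t z}"
      obtain i j k l where zz: "z = (i, j, k, l)" by (cases z) auto
      then have "0 \<le> ?t z" using z row_hstar_nonneg_terms(2)[OF assms, of k j i l] by auto
      then have "?t z = 0" using z by auto
      then show "?t z / ?D = 0" by simp
    qed
  qed auto
  also have "\<dots> = (\<Sum>(q1, q2, q3, q4)\<in>?S. ?x q4 * (?x q3 - 1) * (?x q2 - 2) * (?x q1 - 3) / ?D)"
    by (rule sum.reindex_bij_witness[of _ "\<lambda>(q1, q2, q3, q4). (Suc q4, Suc q3, Suc q2, Suc q1)"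
          "\<lambda>(i, j, k, l). (l - 1, k - 1, j - 1, i - 1)"])
       (auto simp: row_length_def)
  also have "\<dots> = (\<Sum>q1\<in>{0..<?r}. \<Sum>q2\<in>{q1..<?r}. \<Sum>q3\<in>{q2..<?r}. \<Sum>q4\<in>{q3..<?r}.
      ?x q4 * (?x q3 - 1) * (?x q2 - 2) * (?x q1 - 3) / ?D)"
    by (simp add: sum.Sigma)
  also have "\<dots> = row_hstar \<mu> 4 / ?D"
    unfolding row_hstar_def four hstar.simps sum_distrib_left sum_divide_distrib
    by (intro sum.cong refl) simp
  finally show ?thesis .
qed

lemma sum_upper_triangle:
  fixes x :: "nat \<Rightarrow> real"
  shows "2 * (\<Sum>q=0..<r. (x q - 1) * (\<Sum>p=q..<r. x p))
    = (\<Sum>q<r. x q)\<^sup>2 + (\<Sum>q<r. (x q)\<^sup>2) - 2 * (\<Sum>q<r. x q) - 2 * (\<Sum>q<r. real q * x q)"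
proof (induction r)
  case (Suc r)
  have "(\<Sum>q=0..<Suc r. (x q - 1) * (\<Sum>p=q..<Suc r. x p))
      = (\<Sum>q=0..<r. (x q - 1) * (\<Sum>p=q..<r. x p) + (x q - 1) * x r) + (x r - 1) * x r"
    by (simp add: distrib_left)
  also have "\<dots> = (\<Sum>q=0..<r. (x q - 1) * (\<Sum>p=q..<r. x p)) + ((\<Sum>q<r. x q) - real r) * x r + (x r - 1) * x r"
    by (simp add: sum.distrib sum_distrib_right[symmetric] sum_subtractf atLeast0LessThan)
  finally show ?case using Suc by (simp add: power2_eq_square algebra_simps)
qed simp

lemma sum_diagram:
  "(\<Sum>(i, j)\<in>diagram \<mu>. g i j) = (\<Sum>j<length \<mu>. \<Sum>i<row_length \<mu> j. g (Suc i) (Suc j))"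
proof -
  have "(\<Sum>(i, j)\<in>diagram \<mu>. g i j)
      = (\<Sum>z\<in>Sigma {..<length \<mu>} (\<lambda>j. {..<row_length \<mu> j}). (\<lambda>(i, j). g i j) ((\<lambda>(j, i). (Suc i, Suc j)) z))"
    by (rule sum.reindex_bij_betw[symmetric, OF bij_betw_diagram])
  also have "\<dots> = (\<Sum>j<length \<mu>. \<Sum>i<row_length \<mu> j. g (Suc i) (Suc j))"
    by (subst sum.Sigma) (auto intro!: sum.cong)
  finally show ?thesis .
qed

text \<open>
  Both sides are twice the sum of the column numbers (from 0) of the cells of
  \<open>\<mu>\<close>, summed by columns on the left and by rows on the right.\<close>

lemma conjugate_content_sum:
  assumes "is_partition \<mu> n"
  shows "2 * (\<Sum>q<length (conjugate \<mu>). real q * real (row_length (conjugate \<mu>) q))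
    = (\<Sum>j<length \<mu>. real (row_length \<mu> j) * (real (row_length \<mu> j) - 1))"
proof -
  have "(\<Sum>q<length (conjugate \<mu>). real q * real (row_length (conjugate \<mu>) q))
      = (\<Sum>(i, j)\<in>diagram (conjugate \<mu>). real (j - 1))"
    by (simp add: sum_diagram mult.commute)
  also have "\<dots> = (\<Sum>(i, j)\<in>diagram \<mu>. real (i - 1))"
    unfolding diagram_conjugate[OF assms]
    by (subst sum.reindex[OF inj_on_subset[OF inj_swap subset_UNIV]]) (auto intro!: sum.cong)
  also have "\<dots> = (\<Sum>j<length \<mu>. \<Sum>i<row_length \<mu> j. real i)" by (simp add: sum_diagram)
  also have "2 * \<dots> = (\<Sum>j<length \<mu>. real (row_length \<mu> j) * (real (row_length \<mu> j) - 1))"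
    unfolding sum_distrib_left
  proof (rule sum.cong)
    fix j
    have "2 * (\<Sum>i<m. real i) = real m * (real m - 1)" for m by (induction m) (auto simp: algebra_simps)
    then show "(\<Sum>i<row_length \<mu> j. 2 * real i) = real (row_length \<mu> j) * (real (row_length \<mu> j) - 1)"
      by (simp add: sum_distrib_left)
  qed simp
  finally show ?thesis by simp
qed

text \<open>
  Completing the square turns \<open>h\<^sup>*\<^sub>2(\<mu>')\<close> into squares of the parts
  of \<open>\<mu>'\<close> and the sum of \<open>q \<mu>'\<^sub>q\<^sub>+\<^sub>1\<close>, which
  the double count \<open>conjugate_content_sum\<close> rewrites by parts of \<open>\<mu>\<close>.\<close>

lemma c_conj_eq:
  assumes "n \<ge> 2" "is_partition \<mu> n"
  shows "c_conj \<mu> = row_hstar (conjugate \<mu>) 2 / (real n * (real n - 1))"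
proof -
  let ?m = "conjugate \<mu>"
  let ?x = "\<lambda>q. real (row_length ?m q)" and ?y = "\<lambda>q. real (row_length \<mu> q)"
  let ?D = "real n * (real n - 1)"
  have D: "?D \<noteq> 0" using assms(1) by simp
  have len: "sum_list \<mu> = n" "sum_list ?m = n"
    using assms(2) is_partition_conjugate[OF assms(2)] by (auto simp: is_partition_def)
  have shift: "(\<Sum>i=1..length \<kappa>. g (part \<kappa> i)) = (\<Sum>q<length \<kappa>. g (row_length \<kappa> q))"
    for \<kappa> and g :: "nat \<Rightarrow> real"
    by (rule sum.reindex_bij_witness[of _ Suc "\<lambda>i. i - 1"]) (auto simp: row_length_def)
  have sx: "(\<Sum>q<length ?m. ?x q) = real n"
    unfolding of_nat_sum[symmetric] sum_row_length len ..
  have "2 * row_hstar ?m 2 = 2 * (\<Sum>q=0..<length ?m. (?x q - 1) * (\<Sum>p=q..<length ?m. ?x p))"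
    by (simp add: row_hstar_def numeral_2_eq_2)
  also have "\<dots> = (real n)\<^sup>2 + (\<Sum>q<length ?m. (?x q)\<^sup>2) - 2 * real n - (\<Sum>j<length \<mu>. ?y j * (?y j - 1))"
    unfolding sum_upper_triangle sx conjugate_content_sum[OF assms(2)] ..
  finally have h: "2 * row_hstar ?m 2
      = (real n)\<^sup>2 + (\<Sum>q<length ?m. (?x q)\<^sup>2) - 2 * real n - (\<Sum>j<length \<mu>. ?y j * (?y j - 1))" .
  have "(\<Sum>q<length ?m. ?x q * (?x q - 1)) = (\<Sum>q<length ?m. (?x q)\<^sup>2) - real n"
    using sx by (simp add: right_diff_distrib sum_subtractf power2_eq_square)
  then have e: "2 * row_hstar ?m 2 = ?D + (\<Sum>q<length ?m. ?x q * (?x q - 1)) - (\<Sum>j<length \<mu>. ?y j * (?y j - 1))"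
    using h by (simp add: power2_eq_square algebra_simps)
  have "c_conj \<mu> = 1 / 2 * (1 + (\<Sum>q<length ?m. ?x q * (?x q - 1)) / ?D - (\<Sum>j<length \<mu>. ?y j * (?y j - 1)) / ?D)"
    unfolding c_conj_def Let_def len(1) sum_divide_distrib
    using shift[where \<kappa> = ?m and g = "\<lambda>p. real p * (real p - 1) / ?D"]
      shift[where \<kappa> = \<mu> and g = "\<lambda>p. real p * (real p - 1) / ?D"] by simp
  also have "\<dots> = 1 / 2 * (2 * row_hstar ?m 2 / ?D)"
    unfolding e add_divide_distrib diff_divide_distrib using D by simp
  finally show ?thesis by simp
qed

section \<open>Counting tableaux by descent patterns\<close>

text \<open>
  A ballot word starts with the letter 0, so \<open>k\<close> initial non-ascents mean \<open>k +
  1\<close> initial zeros.\<close>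

lemma card_no_initial_descents:
  assumes "is_partition \<mu> n" "k < n"
  shows "real (card {T \<in> SYT \<mu>. \<forall>i<k. Suc i \<notin> descents \<mu> T}) * ffact (real n) (Suc k)
    = real (card (SYT \<mu>)) * row_hstar \<mu> (Suc k)"
proof -
  let ?a = "row_length \<mu>"
  have n: "(\<Sum>i<length \<mu>. ?a i) = n" using assms(1) by (simp add: sum_row_length is_partition_def)
  have "{T \<in> SYT \<mu>. \<forall>i<k. Suc i \<notin> descents \<mu> T} = {T \<in> SYT \<mu>. \<forall>i<k. \<not> asc (word_of \<mu> T) i}"
    using descents_asc[OF _ assms(1)] by auto
  then have "card {T \<in> SYT \<mu>. \<forall>i<k. Suc i \<notin> descents \<mu> T}
      = card {w \<in> ballot_words ?a. \<forall>i<k. \<not> asc w i}"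
    using card_SYT_word[OF assms(1), of "\<lambda>w. \<forall>i<k. \<not> asc w i"] by simp
  also have "{w \<in> ballot_words ?a. \<forall>i<k. \<not> asc w i}
      = {w \<in> ballot_words ?a. take (Suc k) w = replicate (Suc k) 0}"
    using take_replicate_iff_no_asc row_word_facts(2)[OF assms(1)] assms(2)
    by (auto simp: ballot_words_def simp del: replicate_Suc)
  finally show ?thesis
    using card_ballot_words_row_prefix[OF shape_row_length[OF assms(1)], of "Suc k"] assms(2) n
      card_SYT[OF assms(1)] of_nat_sum[of ?a "{..<length \<mu>}", where ?'a = real]
    by (simp add: row_hstar_def del: of_nat_sum replicate_Suc)
qed

lemma card_initial_descents_conjugate:
  assumes "is_partition \<mu> n" "k < n"
  shows "card {T \<in> SYT \<mu>. \<forall>i<k. Suc i \<in> descents \<mu> T}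
    = card {T \<in> SYT (conjugate \<mu>). \<forall>i<k. Suc i \<notin> descents (conjugate \<mu>) T}"
proof -
  let ?c = "conjugate \<mu>"
  note dc = diagram_conjugate[OF assms(1)] and sc = sum_list_conjugate[OF assms(1)]
  have n: "sum_list \<mu> = n" using assms(1) by (simp add: is_partition_def)
  have dc': "diagram \<mu> = prod.swap ` diagram ?c" unfolding dc by (simp add: image_image)
  note T = transpose_tableau_SYT[OF _ dc sc] and T' = transpose_tableau_SYT[OF _ dc' sc[symmetric]]
  note inv = transpose_tableau_involution[OF _ dc] and inv' = transpose_tableau_involution[OF _ dc']
  have des: "Suc i \<in> descents ?c (transpose_tableau \<mu> U) \<longleftrightarrow> Suc i \<notin> descents \<mu> U"
    if "U \<in> SYT \<mu>" "i < k" for U i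
    using descents_transpose[OF that(1) assms(1), of "Suc i"] that(2) assms(2) n by simp
  show ?thesis
  proof (rule bij_betw_same_card[of "transpose_tableau \<mu>"],
         rule bij_betw_byWitness[where f' = "transpose_tableau ?c"])
    show "transpose_tableau ?c ` {T \<in> SYT ?c. \<forall>i<k. Suc i \<notin> descents ?c T}
        \<subseteq> {T \<in> SYT \<mu>. \<forall>i<k. Suc i \<in> descents \<mu> T}"
    proof (intro subsetI CollectI, elim imageE)
      fix V U assume U: "U \<in> {T \<in> SYT ?c. \<forall>i<k. Suc i \<notin> descents ?c T}" and V: "V = transpose_tableau ?c U"
      then have VS: "V \<in> SYT \<mu>" and "transpose_tableau \<mu> V = U" using T'[of U] inv'[of U] by auto
      then show "V \<in> SYT \<mu> \<and> (\<forall>i<k. Suc i \<in> descents \<mu> V)" using U des[OF VS] by auto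
    qed
  qed (use T inv inv' des in auto)
qed

lemma card_SYT_conjugate:
  assumes "is_partition \<mu> n" "n > 0"
  shows "card (SYT (conjugate \<mu>)) = card (SYT \<mu>)"
  using card_initial_descents_conjugate[OF assms(1), of 0] assms(2) by simp

lemma card_initial_descents:
  assumes "is_partition \<mu> n" "k < n"
  shows "real (card {T \<in> SYT \<mu>. \<forall>i<k. Suc i \<in> descents \<mu> T}) * ffact (real n) (Suc k)
    = real (card (SYT \<mu>)) * row_hstar (conjugate \<mu>) (Suc k)"
  using card_no_initial_descents[OF is_partition_conjugate[OF assms(1)] assms(2)]
    card_initial_descents_conjugate[OF assms] card_SYT_conjugate[OF assms(1)] assms(2) by simp

lemma descent_pattern_counts:
  assumes "is_partition \<mu> n" "n \<ge> 2"
  defines "N \<equiv> real (card (SYT \<mu>))"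
  defines "D \<equiv> descents \<mu>"
  shows "real (card {T \<in> SYT \<mu>. 1 \<in> D T}) = N * c_conj \<mu>"
    and "n \<ge> 3 \<Longrightarrow> real (card {T \<in> SYT \<mu>. 1 \<in> D T \<and> 2 \<in> D T}) = N * d_coeff (conjugate \<mu>)"
    and "n \<ge> 3 \<Longrightarrow> real (card {T \<in> SYT \<mu>. 1 \<notin> D T \<and> 2 \<notin> D T}) = N * d_coeff \<mu>"
    and "n \<ge> 4 \<Longrightarrow> real (card {T \<in> SYT \<mu>. 1 \<in> D T \<and> 2 \<in> D T \<and> 3 \<in> D T}) = N * e_coeff (conjugate \<mu>)"
    and "n \<ge> 4 \<Longrightarrow> real (card {T \<in> SYT \<mu>. 1 \<notin> D T \<and> 2 \<notin> D T \<and> 3 \<notin> D T}) = N * e_coeff \<mu>"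
proof -
  have less: "(\<forall>i<1. Suc i \<in> S) \<longleftrightarrow> 1 \<in> S" "(\<forall>i<2. Suc i \<in> S) \<longleftrightarrow> 1 \<in> S \<and> 2 \<in> S"
    "(\<forall>i<3. Suc i \<in> S) \<longleftrightarrow> 1 \<in> S \<and> 2 \<in> S \<and> 3 \<in> S"
    "(\<forall>i<2. Suc i \<notin> S) \<longleftrightarrow> 1 \<notin> S \<and> 2 \<notin> S"
    "(\<forall>i<3. Suc i \<notin> S) \<longleftrightarrow> 1 \<notin> S \<and> 2 \<notin> S \<and> 3 \<notin> S" for S :: "nat set"
    by (auto simp: numeral_2_eq_2 numeral_3_eq_3 less_Suc_eq)
  have ff: "ffact (real n) 2 = real n * (real n - 1)"
    "ffact (real n) 3 = real n * (real n - 1) * (real n - 2)"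
    "ffact (real n) 4 = real n * (real n - 1) * (real n - 2) * (real n - 3)"
    by (simp_all add: ffact_def eval_nat_numeral)
  have nz: "ffact (real n) (Suc k) \<noteq> 0" if "k < n" for k
    using ffact_pos[of "Suc k" "real n"] that by simp
  have col: "real (card {T \<in> SYT \<mu>. \<forall>i<k. Suc i \<in> D T}) = N * (row_hstar (conjugate \<mu>) (Suc k) / ffact (real n) (Suc k))"
    if "k < n" for k
    using card_initial_descents[OF assms(1) that] nz[OF that] by (simp add: N_def D_def field_simps)
  have row: "real (card {T \<in> SYT \<mu>. \<forall>i<k. Suc i \<notin> D T}) = N * (row_hstar \<mu> (Suc k) / ffact (real n) (Suc k))"
    if "k < n" for k
    using card_no_initial_descents[OF assms(1) that] nz[OF that] by (simp add: N_def D_def field_simps)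
  have sucs: "Suc 1 = 2" "Suc 2 = 3" "Suc 3 = 4" by auto
  note conj = is_partition_conjugate[OF assms(1)]
  show "real (card {T \<in> SYT \<mu>. 1 \<in> D T}) = N * c_conj \<mu>"
    using col[of 1] assms(2) unfolding less ff sucs c_conj_eq[OF assms(2,1)] by simp
  show "real (card {T \<in> SYT \<mu>. 1 \<in> D T \<and> 2 \<in> D T}) = N * d_coeff (conjugate \<mu>)" if "n \<ge> 3"
    using col[of 2] that unfolding less ff sucs d_coeff_eq[OF conj] by simp
  show "real (card {T \<in> SYT \<mu>. 1 \<notin> D T \<and> 2 \<notin> D T}) = N * d_coeff \<mu>" if "n \<ge> 3"
    using row[of 2] that unfolding less ff sucs d_coeff_eq[OF assms(1)] by simp
  show "real (card {T \<in> SYT \<mu>. 1 \<in> D T \<and> 2 \<in> D T \<and> 3 \<in> D T}) = N * e_coeff (conjugate \<mu>)" if "n \<ge> 4"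
    using col[of 3] that unfolding less ff sucs e_coeff_eq[OF conj] by simp
  show "real (card {T \<in> SYT \<mu>. 1 \<notin> D T \<and> 2 \<notin> D T \<and> 3 \<notin> D T}) = N * e_coeff \<mu>" if "n \<ge> 4"
    using row[of 3] that unfolding less ff sucs e_coeff_eq[OF assms(1)] by simp
qed

lemma card_descent_positions:
  assumes "is_partition \<mu> n"
  defines "D \<equiv> descents \<mu>"
  shows "1 \<le> m \<Longrightarrow> m < n \<Longrightarrow> card {T \<in> SYT \<mu>. m \<in> D T} = card {T \<in> SYT \<mu>. 1 \<in> D T}"
    and "1 \<le> m \<Longrightarrow> m + 1 < n \<Longrightarrow>
      card {T \<in> SYT \<mu>. m \<in> D T \<and> m + 1 \<in> D T} = card {T \<in> SYT \<mu>. 1 \<in> D T \<and> 2 \<in> D T}"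
    and "1 \<le> l \<Longrightarrow> l + 1 < m \<Longrightarrow> m < n \<Longrightarrow>
      card {T \<in> SYT \<mu>. l \<in> D T \<and> m \<in> D T} = card {T \<in> SYT \<mu>. 1 \<in> D T \<and> 3 \<in> D T}"
proof -
  let ?W = "ballot_words (row_length \<mu>)"
  have D: "{T \<in> SYT \<mu>. Suc k \<in> D T} = {T \<in> SYT \<mu>. asc (word_of \<mu> T) k}"
    "{T \<in> SYT \<mu>. Suc k \<in> D T \<and> Suc l \<in> D T} = {T \<in> SYT \<mu>. asc (word_of \<mu> T) k \<and> asc (word_of \<mu> T) l}" for k l
    using descents_asc[OF _ assms(1)] by (auto simp: D_def)
  have one: "card {T \<in> SYT \<mu>. Suc k \<in> D T} = card {w \<in> ?W. asc w k}" for k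
    unfolding D by (rule card_SYT_word[OF assms(1)])
  have two: "card {T \<in> SYT \<mu>. Suc k \<in> D T \<and> Suc l \<in> D T} = card {w \<in> ?W. asc w k \<and> asc w l}" for k l
    unfolding D by (rule card_SYT_word[OF assms(1), of "\<lambda>w. asc w k \<and> asc w l"])
  note W = row_word_facts[OF assms(1)]
  show "card {T \<in> SYT \<mu>. m \<in> D T} = card {T \<in> SYT \<mu>. 1 \<in> D T}" if "1 \<le> m" "m < n"
    using one[of "m - 1"] one[of 0] card_asc[OF W, of "m - 1"] that by simp
  show "card {T \<in> SYT \<mu>. m \<in> D T \<and> m + 1 \<in> D T} = card {T \<in> SYT \<mu>. 1 \<in> D T \<and> 2 \<in> D T}"
    if "1 \<le> m" "m + 1 < n"
    using two[of "m - 1" m] two[of 0 1] card_double_asc[OF W, of "m - 1"] that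
    by (simp add: numeral_2_eq_2)
  show "card {T \<in> SYT \<mu>. l \<in> D T \<and> m \<in> D T} = card {T \<in> SYT \<mu>. 1 \<in> D T \<and> 3 \<in> D T}"
    if "1 \<le> l" "l + 1 < m" "m < n"
    using two[of "l - 1" "m - 1"] two[of 0 2] card_separated_asc[OF W, of "l - 1" "m - 1"] that
    by (simp add: numeral_3_eq_3)
qed

lemma card_split:
  assumes "finite A"
  shows "real (card {x \<in> A. P x}) = real (card {x \<in> A. P x \<and> Q x}) + real (card {x \<in> A. P x \<and> \<not> Q x})"
proof -
  have "{x \<in> A. P x} = {x \<in> A. P x \<and> Q x} \<union> {x \<in> A. P x \<and> \<not> Q x}" by auto
  then have "card {x \<in> A. P x} = card {x \<in> A. P x \<and> Q x} + card {x \<in> A. P x \<and> \<not> Q x}"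
    using assms by (simp add: card_Un_disjoint Int_def)
  then show ?thesis by simp
qed

text \<open>
  Among the tableaux with a descent at 1, remove those without a descent at 3, separated by
  whether 2 is a descent. Those with a descent at 2 are counted by \<open>d' - e'\<close>. The
  others avoid the descents 2 and 3 and have the descent 1; by position independence they are
  counted by \<open>d - e\<close>.\<close>

lemma card_descents_1_3:
  assumes "is_partition \<mu> n" "n \<ge> 4"
  shows "real (card {T \<in> SYT \<mu>. 1 \<in> descents \<mu> T \<and> 3 \<in> descents \<mu> T}) = real (card (SYT \<mu>))
    * (c_conj \<mu> - d_coeff \<mu> - d_coeff (conjugate \<mu>) + e_coeff \<mu> + e_coeff (conjugate \<mu>))"
proof -
  define cnt where "cnt P = real (card {T \<in> SYT \<mu>. P (descents \<mu> T)})" for P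
  note fin = finite_SYT[OF assms(1)]
  have split: "cnt P = cnt (\<lambda>D. P D \<and> Q D) + cnt (\<lambda>D. P D \<and> \<not> Q D)" for P Q
    unfolding cnt_def by (rule card_split[OF fin])
  have n: "n \<ge> 2" "n \<ge> 3" using assms(2) by auto
  note counts = descent_pattern_counts[OF assms(1) n(1)]
  note pos = card_descent_positions[OF assms(1)]
  let ?N = "real (card (SYT \<mu>))"
  have N: "cnt (\<lambda>D. True) = ?N" by (simp add: cnt_def)
  have A: "cnt (\<lambda>D. 1 \<in> D) = ?N * c_conj \<mu>" using counts(1) by (simp add: cnt_def)
  have A2: "cnt (\<lambda>D. 2 \<in> D) = cnt (\<lambda>D. 1 \<in> D)" and A3: "cnt (\<lambda>D. 3 \<in> D) = cnt (\<lambda>D. 1 \<in> D)"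
    using pos(1)[of 2] pos(1)[of 3] assms(2) by (simp_all add: cnt_def)
  have B: "cnt (\<lambda>D. 1 \<in> D \<and> 2 \<in> D) = ?N * d_coeff (conjugate \<mu>)" using counts(2) n by (simp add: cnt_def)
  have B': "cnt (\<lambda>D. 1 \<notin> D \<and> 2 \<notin> D) = ?N * d_coeff \<mu>" using counts(3) n by (simp add: cnt_def)
  have B2: "cnt (\<lambda>D. 2 \<in> D \<and> 3 \<in> D) = cnt (\<lambda>D. 1 \<in> D \<and> 2 \<in> D)"
    using pos(2)[of 2] assms(2) by (simp add: cnt_def)
  have E: "cnt (\<lambda>D. (1 \<in> D \<and> 2 \<in> D) \<and> 3 \<in> D) = ?N * e_coeff (conjugate \<mu>)"
    using counts(4) assms(2) by (simp add: cnt_def)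
  have E': "cnt (\<lambda>D. (2 \<notin> D \<and> 3 \<notin> D) \<and> \<not> 1 \<in> D) = ?N * e_coeff \<mu>"
    using counts(5) assms(2) by (simp add: cnt_def conj_ac)
  have neither: "cnt (\<lambda>D. a \<notin> D \<and> b \<notin> D) = ?N - cnt (\<lambda>D. a \<in> D) - cnt (\<lambda>D. b \<in> D) + cnt (\<lambda>D. a \<in> D \<and> b \<in> D)"
    for a b
    using split[of "\<lambda>D. True" "\<lambda>D. a \<in> D"] split[of "\<lambda>D. a \<notin> D" "\<lambda>D. b \<in> D"]
      split[of "\<lambda>D. b \<in> D" "\<lambda>D. a \<in> D"] N by (simp add: conj_commute)
  have "cnt (\<lambda>D. 2 \<notin> D \<and> 3 \<notin> D) = cnt (\<lambda>D. 1 \<notin> D \<and> 2 \<notin> D)"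
    unfolding neither A2 A3 B2 by simp
  then have NN: "cnt (\<lambda>D. (2 \<notin> D \<and> 3 \<notin> D) \<and> 1 \<in> D) = ?N * d_coeff \<mu> - ?N * e_coeff \<mu>"
    using split[of "\<lambda>D. 2 \<notin> D \<and> 3 \<notin> D" "\<lambda>D. 1 \<in> D"] B' E' by simp
  have AA: "cnt (\<lambda>D. (1 \<in> D \<and> 2 \<in> D) \<and> \<not> 3 \<in> D) = ?N * d_coeff (conjugate \<mu>) - ?N * e_coeff (conjugate \<mu>)"
    using split[of "\<lambda>D. 1 \<in> D \<and> 2 \<in> D" "\<lambda>D. 3 \<in> D"] B E by simp
  have "cnt (\<lambda>D. 1 \<in> D \<and> \<not> 3 \<in> D) = cnt (\<lambda>D. (1 \<in> D \<and> \<not> 3 \<in> D) \<and> 2 \<in> D) + cnt (\<lambda>D. (1 \<in> D \<and> \<not> 3 \<in> D) \<and> \<not> 2 \<in> D)"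
    by (rule split)
  also have "(\<lambda>D. (1 \<in> D \<and> \<not> 3 \<in> D) \<and> 2 \<in> D) = (\<lambda>D. ((1::nat) \<in> D \<and> 2 \<in> D) \<and> \<not> 3 \<in> D)" by auto
  also have "(\<lambda>D. (1 \<in> D \<and> \<not> 3 \<in> D) \<and> \<not> 2 \<in> D) = (\<lambda>D. (2 \<notin> D \<and> 3 \<notin> D) \<and> (1::nat) \<in> D)" by auto
  finally have "cnt (\<lambda>D. 1 \<in> D \<and> 3 \<in> D) = ?N * c_conj \<mu>
      - (?N * d_coeff (conjugate \<mu>) - ?N * e_coeff (conjugate \<mu>)) - (?N * d_coeff \<mu> - ?N * e_coeff \<mu>)"
    using split[of "\<lambda>D. 1 \<in> D" "\<lambda>D. 3 \<in> D"] A AA NN by simp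
  then show ?thesis by (simp add: cnt_def algebra_simps)
qed

section \<open>Expectation and variance\<close>

text \<open>
  Separates a double sum whose coefficients depend only on the distance class 0, 1 or at least 2
  of the indices.\<close>

lemma quadratic_form_by_distance:
  fixes f :: "nat \<Rightarrow> real" and K :: "nat \<Rightarrow> nat \<Rightarrow> real"
  assumes diag: "\<And>i. 1 \<le> i \<Longrightarrow> i < n \<Longrightarrow> K i i = c"
    and adj: "\<And>i. 1 \<le> i \<Longrightarrow> i + 1 < n \<Longrightarrow> K i (i + 1) = d"
    and far: "\<And>i j. 1 \<le> j \<Longrightarrow> j + 1 < i \<Longrightarrow> i < n \<Longrightarrow> K j i = e"
    and sym: "\<And>i j. K i j = K j i"
  shows "(\<Sum>i=1..n-1. \<Sum>j=1..n-1. f i * f j * K i j)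
    = c * (\<Sum>i=1..n-1. (f i)\<^sup>2) + 2 * d * (\<Sum>i=1..n-2. f i * f (i + 1))
      + 2 * e * (\<Sum>(i, j)\<in>{(i, j). 1 \<le> j \<and> j < i \<and> i \<le> n - 1 \<and> i - j > 1}. f i * f j)"
proof -
  let ?g = "\<lambda>(i, j). f i * f j * K i j"
  let ?I = "{1..n-1}"
  let ?L = "{(i, j). 1 \<le> j \<and> j < i \<and> i \<le> n - 1}"
  let ?F = "{(i, j). 1 \<le> j \<and> j < i \<and> i \<le> n - 1 \<and> i - j > 1}"
  have finL: "finite ?L" by (rule finite_subset[of _ "?I \<times> ?I"]) auto
  have finF: "finite ?F" by (rule finite_subset[OF _ finL]) auto
  have "?I \<times> ?I = (\<lambda>i. (i, i)) ` ?I \<union> (?L \<union> prod.swap ` ?L)"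
    by (force simp: image_iff)
  then have "(\<Sum>i=1..n-1. \<Sum>j=1..n-1. f i * f j * K i j) = (\<Sum>z\<in>(\<lambda>i. (i, i)) ` ?I \<union> (?L \<union> prod.swap ` ?L). ?g z)"
    by (simp add: sum.cartesian_product)
  also have "\<dots> = (\<Sum>z\<in>(\<lambda>i. (i, i)) ` ?I. ?g z) + ((\<Sum>z\<in>?L. ?g z) + (\<Sum>z\<in>prod.swap ` ?L. ?g z))"
    using finL by (subst sum.union_disjoint, simp, simp, force, subst sum.union_disjoint) auto
  also have "(\<Sum>z\<in>prod.swap ` ?L. ?g z) = (\<Sum>z\<in>?L. ?g z)"
    by (subst sum.reindex[OF inj_on_subset[OF inj_swap subset_UNIV]]) (auto intro!: sum.cong simp: sym mult.commute)
  also have "(\<Sum>z\<in>(\<lambda>i. (i, i)) ` ?I. ?g z) = c * (\<Sum>i=1..n-1. (f i)\<^sup>2)"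
    unfolding sum_distrib_left
    by (subst sum.reindex) (auto intro!: inj_onI sum.cong simp: diag power2_eq_square mult.commute)
  also have "(\<Sum>z\<in>?L. ?g z) = d * (\<Sum>i=1..n-2. f i * f (i + 1)) + e * (\<Sum>(i, j)\<in>?F. f i * f j)"
  proof -
    have "?L = (\<lambda>i. (i + 1, i)) ` {1..n-2} \<union> ?F"
      by (auto simp: image_iff)
    then have "(\<Sum>z\<in>?L. ?g z) = (\<Sum>z\<in>(\<lambda>i. (i + 1, i)) ` {1..n-2}. ?g z) + (\<Sum>z\<in>?F. ?g z)"
      using finF by (subst sum.union_disjoint[symmetric]) auto
    also have "(\<Sum>z\<in>(\<lambda>i. (i + 1, i)) ` {1..n-2}. ?g z) = d * (\<Sum>i=1..n-2. f i * f (i + 1))"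
      unfolding sum_distrib_left
    proof (subst sum.reindex)
      show "inj_on (\<lambda>i. (i + 1, i)) {1..n-2}" by (auto simp: inj_on_def)
      show "(\<Sum>i\<in>{1..n-2}. (?g \<circ> (\<lambda>i. (i + 1, i))) i) = (\<Sum>i=1..n-2. d * (f i * f (i + 1)))"
      proof (rule sum.cong)
        fix i assume "i \<in> {1..n-2}"
        then have "K (i + 1) i = d" using adj[of i] sym[of i "i + 1"] by auto
        then show "(?g \<circ> (\<lambda>i. (i + 1, i))) i = d * (f i * f (i + 1))" by simp
      qed simp
    qed
    also have "(\<Sum>z\<in>?F. ?g z) = e * (\<Sum>(i, j)\<in>?F. f i * f j)"
      unfolding sum_distrib_left
    proof (rule sum.cong)
      fix z assume "z \<in> ?F"
      then obtain i j where "z = (i, j)" "1 \<le> j" "j + 1 < i" "i < n" by auto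
      then show "?g z = e * (case z of (i, j) \<Rightarrow> f i * f j)" using far[of j i] sym[of i j] by simp
    qed simp
    finally show ?thesis .
  qed
  finally show ?thesis by simp
qed

lemma descent_fun_indicator:
  assumes "sum_list \<mu> = n"
  shows "descent_fun f \<mu> T = (\<Sum>m=1..n-1. f m * of_bool (m \<in> descents \<mu> T))"
proof -
  have "descents \<mu> T \<subseteq> {1..n-1}" using assms by (auto simp: descents_def)
  then show ?thesis
    unfolding descent_fun_def by (intro sum.mono_neutral_cong_left) auto
qed

theorem theorem2p1:
  fixes f :: "nat \<Rightarrow> real" and \<nu> :: "nat list" and n :: nat
  assumes "n \<ge> 2" and "is_partition \<nu> n"
  shows
    "c_conj \<nu> =
       (\<Sum>(i, j)\<in>{(i, j). 1 \<le> j \<and> j \<le> i \<and> i \<le> length (conjugate \<nu>)}.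
          real (part (conjugate \<nu>) i) * (real (part (conjugate \<nu>) j) - 1) / (real n * (real n - 1)))
     \<and> real (card (SYT \<nu>)) =
         fact n * (\<Prod>(i, j)\<in>diagram \<nu>.
           inverse (real (part (conjugate \<nu>) i) + real (part \<nu> j) - real i - real j + 1))
     \<and> expectation_SYT \<nu> (descent_fun f \<nu>) = c_conj \<nu> * (\<Sum>i=1..n-1. f i)
     \<and> variance_SYT \<nu> (descent_fun f \<nu>) =
         c_conj \<nu> * (\<Sum>i=1..n-1. (f i)\<^sup>2)
         + 2 * d_coeff (conjugate \<nu>) * (\<Sum>i=1..n-2. f i * f (i + 1))
         + 2 * (c_conj \<nu> - d_coeff \<nu> - d_coeff (conjugate \<nu>) + e_coeff \<nu> + e_coeff (conjugate \<nu>))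
             * (\<Sum>(i, j)\<in>{(i, j). 1 \<le> j \<and> j < i \<and> i \<le> n - 1 \<and> i - j > 1}. f i * f j)
         - (c_conj \<nu> * (\<Sum>i=1..n-1. f i))\<^sup>2"
proof -
  let ?S = "SYT \<nu>" and ?X = "descent_fun f \<nu>"
  let ?N = "real (card ?S)"
  let ?x = "c_conj \<nu> - d_coeff \<nu> - d_coeff (conjugate \<nu>) + e_coeff \<nu> + e_coeff (conjugate \<nu>)"
  have n: "sum_list \<nu> = n" using assms(2) by (simp add: is_partition_def)
  have fin: "finite ?S" by (rule finite_SYT[OF assms(2)])
  have hook: "?N = fact n * (\<Prod>(i, j)\<in>diagram \<nu>.
      inverse (real (part (conjugate \<nu>) i) + real (part \<nu> j) - real i - real j + 1))"
    by (rule hook_length_formula[OF assms(2)])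
  have ne: "?S \<noteq> {}" by (rule SYT_nonempty[OF assms(2)])
  have N: "?N > 0" using fin ne by (simp add: card_gt_0_iff)
  have X: "?X T = (\<Sum>m=1..n-1. f m * of_bool (m \<in> descents \<nu> T))" for T
    by (rule descent_fun_indicator[OF n])
  have count: "(\<Sum>T\<in>?S. of_bool (P T)) = real (card {T \<in> ?S. P T})" for P
    by (simp add: fin Int_def)
  note counts = descent_pattern_counts[OF assms(2,1)]
  note pos = card_descent_positions[OF assms(2)]
  define K where "K i j = real (card {T \<in> ?S. i \<in> descents \<nu> T \<and> j \<in> descents \<nu> T})" for i j
  have single: "real (card {T \<in> ?S. m \<in> descents \<nu> T}) = ?N * c_conj \<nu>" if "1 \<le> m" "m < n" for m
    using pos(1)[OF that] counts(1) by simp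
  have "(\<Sum>T\<in>?S. ?X T) = (\<Sum>m=1..n-1. \<Sum>T\<in>?S. f m * of_bool (m \<in> descents \<nu> T))"
    unfolding X by (rule sum.swap)
  also have "\<dots> = (\<Sum>m=1..n-1. f m * (?N * c_conj \<nu>))"
  proof (rule sum.cong)
    fix m assume "m \<in> {1..n-1}"
    then have "1 \<le> m" "m < n" using assms(1) by auto
    then show "(\<Sum>T\<in>?S. f m * of_bool (m \<in> descents \<nu> T)) = f m * (?N * c_conj \<nu>)"
      unfolding sum_distrib_left[symmetric] count by (simp add: single)
  qed simp
  finally have sumX: "(\<Sum>T\<in>?S. ?X T) = ?N * (c_conj \<nu> * (\<Sum>i=1..n-1. f i))"
    unfolding sum_distrib_right[symmetric] by (simp add: mult_ac)
  have "(\<Sum>T\<in>?S. (?X T)\<^sup>2)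
      = (\<Sum>T\<in>?S. \<Sum>i=1..n-1. \<Sum>j=1..n-1. f i * f j * of_bool (i \<in> descents \<nu> T \<and> j \<in> descents \<nu> T))"
    unfolding X power2_eq_square sum_product by (intro sum.cong refl) simp
  also have "\<dots> = (\<Sum>i=1..n-1. \<Sum>j=1..n-1. \<Sum>T\<in>?S. f i * f j * of_bool (i \<in> descents \<nu> T \<and> j \<in> descents \<nu> T))"
    by (subst sum.swap) (intro sum.cong refl sum.swap)
  also have "\<dots> = (\<Sum>i=1..n-1. \<Sum>j=1..n-1. f i * f j * K i j)"
    unfolding sum_distrib_left[symmetric] count K_def ..
  also have "\<dots> = (?N * c_conj \<nu>) * (\<Sum>i=1..n-1. (f i)\<^sup>2)
      + 2 * (?N * d_coeff (conjugate \<nu>)) * (\<Sum>i=1..n-2. f i * f (i + 1))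
      + 2 * (?N * ?x) * (\<Sum>(i, j)\<in>{(i, j). 1 \<le> j \<and> j < i \<and> i \<le> n - 1 \<and> i - j > 1}. f i * f j)"
  proof (rule quadratic_form_by_distance)
    show "K i i = ?N * c_conj \<nu>" if "1 \<le> i" "i < n" for i
      using single[OF that] by (simp add: K_def)
    show "K i (i + 1) = ?N * d_coeff (conjugate \<nu>)" if "1 \<le> i" "i + 1 < n" for i
      unfolding K_def pos(2)[OF that] using that by (intro counts(2)) simp
    show "K j i = ?N * ?x" if "1 \<le> j" "j + 1 < i" "i < n" for i j
      unfolding K_def pos(3)[OF that] using that by (intro card_descents_1_3[OF assms(2)]) simp
    show "K i j = K j i" for i j by (simp add: K_def conj_commute)
  qed
  finally have sumX2: "(\<Sum>T\<in>?S. (?X T)\<^sup>2) = ?N * (c_conj \<nu> * (\<Sum>i=1..n-1. (f i)\<^sup>2)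
      + 2 * d_coeff (conjugate \<nu>) * (\<Sum>i=1..n-2. f i * f (i + 1))
      + 2 * ?x * (\<Sum>(i, j)\<in>{(i, j). 1 \<le> j \<and> j < i \<and> i \<le> n - 1 \<and> i - j > 1}. f i * f j))"
    by (simp add: algebra_simps)
  have E: "expectation_SYT \<nu> Y = (\<Sum>T\<in>?S. Y T) / ?N" for Y
    unfolding expectation_SYT_def by (rule integral_pmf_of_set[OF ne fin])
  have EX: "expectation_SYT \<nu> ?X = c_conj \<nu> * (\<Sum>i=1..n-1. f i)"
    unfolding E sumX using N by simp
  have int: "integrable (measure_pmf (pmf_of_set ?S)) Y" for Y :: "_ \<Rightarrow> real"
    by (rule integrable_measure_pmf_finite) (simp add: set_pmf_of_set[OF ne fin] fin)
  have "variance_SYT \<nu> ?X = expectation_SYT \<nu> (\<lambda>T. (?X T)\<^sup>2) - (expectation_SYT \<nu> ?X)\<^sup>2"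
    unfolding variance_SYT_def expectation_SYT_def by (rule measure_pmf.variance_eq[OF int int])
  also have "\<dots> = c_conj \<nu> * (\<Sum>i=1..n-1. (f i)\<^sup>2)
      + 2 * d_coeff (conjugate \<nu>) * (\<Sum>i=1..n-2. f i * f (i + 1))
      + 2 * ?x * (\<Sum>(i, j)\<in>{(i, j). 1 \<le> j \<and> j < i \<and> i \<le> n - 1 \<and> i - j > 1}. f i * f j)
      - (c_conj \<nu> * (\<Sum>i=1..n-1. f i))\<^sup>2"
    unfolding EX unfolding E sumX2 using N by simp
  finally show ?thesis
    using c_conj_eq[OF assms] hstar_2_sum[of "conjugate \<nu>"] hook EX by simp
qed

end
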